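(* Let $G=(X,b,m)$ be a connected, locally finite weighted graph. If $\inf_{x\in X}m(x)>0$, then $G$ is Feller.
   Context: Weighted graph: $G=(X,b,m)$ where $X$ is a countably infinite set (vertices), $b:X\times X\to[0,\infty)$ satisfies $b(x,y)=b(y,x)$, $b(x,x)=0$ and $|\{y : b(x,y)>0\}|<\infty$ for all $x$ (local finiteness), and $m:X\to(0,\infty)$ is a vertex measure. Write $x\sim y$ if $b(x,y)>0$. $G$ is connected if any two vertices are joined by a finite path $x=x_0\sim x_1\sim\dots\sim x_n=y$. Laplacian and heat semigroup: the formal Laplacian is $\widetilde\Delta f(x)=\frac1{m(x)}\sum_{y\in X}b(x,y)(f(x)-f(y))$ for $f:X\to\mathbb{R}$. $C_c(X)$ is the space of finitely supported real functions, and $\ell^2(X,m)$ is the Hilbert space of real functions with $\sum_x f(x)^2m(x)<\infty$, with inner product $\langle f,g\rangle=\sum_x f(x)g(x)m(x)$. $\Delta$ is the Friedrichs extension in $\ell^2(X,m)$ of $\widetilde\Delta|_{C_c(X)}$, i.e. the self-adjoint operator of the closure of the form $\frac12\sum_{x,y}b(x,y)(f(x)-f(y))(g(x)-g(y))$ on $C_c(X)$. The semigroup $P_t=e^{-t\Delta}$ has a heat kernel $p_t(x,y)\ge 0$ and acts on bounded functions by $P_tf(x)=\sum_{y\in X}p_t(x,y)f(y)m(y)$. Feller: $C_0(X)$ is the space of functions vanishing at infinity, i.e. the closure of $C_c(X)$ in the sup norm. $G$ is Feller if $P_t$ maps $C_0(X)$ into $C_0(X)$ for all $t\ge0$. *)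

theory Defs
  imports "HOL-Analysis.Analysis"
begin

section \<open>Weighted graphs\<close>

text \<open>The vertex set is the whole type \<open>'a\<close>. Local finiteness is part of the notion of a
  weighted graph.\<close>

locale weighted_graph =
  fixes b :: "'a \<Rightarrow> 'a \<Rightarrow> real" and m :: "'a \<Rightarrow> real"
  assumes countable_vertices: "countable (UNIV :: 'a set)"
    and infinite_vertices: "infinite (UNIV :: 'a set)"
    and b_nonneg: "b x y \<ge> 0"
    and b_sym: "b x y = b y x"
    and b_irrefl: "b x x = 0"
    and locally_finite: "finite {y. b x y > 0}"
    and m_pos: "m x > 0"

definition graph_connected :: "('a \<Rightarrow> 'a \<Rightarrow> real) \<Rightarrow> bool" where
  "graph_connected b \<longleftrightarrow> (\<forall>x y. (\<lambda>u v. b u v > 0)\<^sup>*\<^sup>* x y)"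

section \<open>Function spaces\<close>

definition fin_supp :: "('a \<Rightarrow> real) set" where
  "fin_supp = {f. finite {x. f x \<noteq> 0}}"

text \<open>The closure of the finitely supported functions in the sup norm.\<close>

definition vanishing_at_infinity :: "('a \<Rightarrow> real) set" where
  "vanishing_at_infinity =
     {f. \<exists>\<phi>. (\<forall>n. \<phi> n \<in> fin_supp) \<and> uniform_limit UNIV \<phi> f sequentially}"

definition l2 :: "('a \<Rightarrow> real) \<Rightarrow> ('a \<Rightarrow> real) set" where
  "l2 m = {f. (\<lambda>x. (f x)\<^sup>2 * m x) summable_on UNIV}"

definition l2_inner :: "('a \<Rightarrow> real) \<Rightarrow> ('a \<Rightarrow> real) \<Rightarrow> ('a \<Rightarrow> real) \<Rightarrow> real" where
  "l2_inner m f g = (\<Sum>\<^sub>\<infinity>x. f x * g x * m x)"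

definition l2_norm :: "('a \<Rightarrow> real) \<Rightarrow> ('a \<Rightarrow> real) \<Rightarrow> real" where
  "l2_norm m f = sqrt (l2_inner m f f)"

section \<open>The Laplacian\<close>

definition formal_laplacian ::
  "('a \<Rightarrow> 'a \<Rightarrow> real) \<Rightarrow> ('a \<Rightarrow> real) \<Rightarrow> ('a \<Rightarrow> real) \<Rightarrow> 'a \<Rightarrow> real" where
  "formal_laplacian b m f x = (\<Sum>\<^sub>\<infinity>y. b x y * (f x - f y)) / m x"

definition energy :: "('a \<Rightarrow> 'a \<Rightarrow> real) \<Rightarrow> ('a \<Rightarrow> real) \<Rightarrow> ('a \<Rightarrow> real) \<Rightarrow> real" where
  "energy b f g = (\<Sum>\<^sub>\<infinity>(x, y). b x y * (f x - f y) * (g x - g y)) / 2"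

text \<open>On finitely supported functions the energy is the quadratic form of the formal Laplacian,
  so the operator of its closure is the Friedrichs extension.\<close>

lemma (in weighted_graph) energy_eq_formal_laplacian:
  assumes "f \<in> fin_supp" "g \<in> fin_supp"
  shows "energy b f g = l2_inner m (formal_laplacian b m f) g"
proof -
  define S where "S = {x. f x \<noteq> 0} \<union> {x. g x \<noteq> 0}"
  define T where "T = S \<union> (\<Union>x\<in>S. {y. b x y > 0})"
  have finS: "finite S" using assms by (simp add: S_def fin_supp_def)
  have finT: "finite T" using finS by (simp add: T_def locally_finite)
  have ST: "S \<subseteq> T" by (simp add: T_def)
  have off: "f x = 0" "g x = 0" if "x \<notin> S" for x using that by (auto simp: S_def)
  have nb: "b x y = 0" if "x \<in> S" "y \<notin> T" for x y
    using that b_nonneg[of x y] by (force simp: T_def)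
  have zero: "b x y * (f x - f y) * (g x - g y) = 0" if "(x, y) \<notin> T \<times> T" for x y
    using that off[of x] off[of y] nb[of x y] nb[of y x] b_sym[of x y] ST
    by (cases "x \<in> S"; cases "y \<in> S") auto
  have "(\<Sum>\<^sub>\<infinity>(x, y). b x y * (f x - f y) * (g x - g y))
      = (\<Sum>\<^sub>\<infinity>(x, y)\<in>T \<times> T. b x y * (f x - f y) * (g x - g y))"
    by (rule infsum_cong_neutral) (use zero in \<open>simp_all add: case_prod_beta mem_Times_iff\<close>)
  also have "\<dots> = (\<Sum>x\<in>T. \<Sum>y\<in>T. b x y * (f x - f y) * (g x - g y))"
    using finT by (simp add: sum.cartesian_product)
  also have "\<dots> = (\<Sum>x\<in>T. \<Sum>y\<in>T. b x y * (f x - f y) * g x)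
               - (\<Sum>x\<in>T. \<Sum>y\<in>T. b x y * (f x - f y) * g y)"
    by (simp add: right_diff_distrib sum_subtractf)
  also have "(\<Sum>x\<in>T. \<Sum>y\<in>T. b x y * (f x - f y) * g y)
           = (\<Sum>x\<in>T. \<Sum>y\<in>T. b y x * (f y - f x) * g x)"
    by (rule sum.swap)
  also have "\<dots> = - (\<Sum>x\<in>T. \<Sum>y\<in>T. b x y * (f x - f y) * g x)"
    unfolding sum_negf[symmetric]
    by (intro sum.cong refl) (simp add: b_sym algebra_simps)
  finally have E: "energy b f g = (\<Sum>x\<in>T. \<Sum>y\<in>T. b x y * (f x - f y) * g x)"
    by (simp add: energy_def)
  have lap: "formal_laplacian b m f x * g x * m x = (\<Sum>y\<in>T. b x y * (f x - f y) * g x)" for x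
  proof (cases "x \<in> S")
    case True
    have "(\<Sum>\<^sub>\<infinity>y. b x y * (f x - f y)) = (\<Sum>\<^sub>\<infinity>y\<in>T. b x y * (f x - f y))"
      by (rule infsum_cong_neutral) (use nb[OF True] in auto)
    then show ?thesis
      using finT m_pos[of x] by (simp add: formal_laplacian_def flip: sum_distrib_right)
  qed (simp add: off)
  have g0: "g x = 0" if "x \<notin> T" for x using that off(2) ST by blast
  have "l2_inner m (formal_laplacian b m f) g
      = (\<Sum>\<^sub>\<infinity>x\<in>T. \<Sum>y\<in>T. b x y * (f x - f y) * g x)"
    unfolding l2_inner_def lap
    by (rule infsum_cong_neutral) (use g0 in \<open>simp_all\<close>)
  with E finT show ?thesis by simp
qed

text \<open>The closure of the form: its domain is the completion of the finitely supported functions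
  with respect to the form norm, realised inside \<open>l2 m\<close>. The guard \<open>f \<in> l2 m\<close> is needed because
  \<open>l2_norm\<close> is only meaningful on \<open>l2 m\<close>.\<close>

definition form_approx ::
  "('a \<Rightarrow> 'a \<Rightarrow> real) \<Rightarrow> ('a \<Rightarrow> real) \<Rightarrow> (nat \<Rightarrow> 'a \<Rightarrow> real) \<Rightarrow> ('a \<Rightarrow> real) \<Rightarrow> bool" where
  "form_approx b m \<phi> f \<longleftrightarrow>
     f \<in> l2 m \<and> (\<forall>n. \<phi> n \<in> fin_supp) \<and>
     (\<lambda>n. l2_norm m (\<lambda>x. \<phi> n x - f x)) \<longlonglongrightarrow> 0 \<and>
     (\<forall>e>0. \<exists>N. \<forall>i\<ge>N. \<forall>j\<ge>N.
        energy b (\<lambda>x. \<phi> i x - \<phi> j x) (\<lambda>x. \<phi> i x - \<phi> j x) < e)"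

definition form_domain :: "('a \<Rightarrow> 'a \<Rightarrow> real) \<Rightarrow> ('a \<Rightarrow> real) \<Rightarrow> ('a \<Rightarrow> real) set" where
  "form_domain b m = {f. \<exists>\<phi>. form_approx b m \<phi> f}"

definition closed_form ::
  "('a \<Rightarrow> 'a \<Rightarrow> real) \<Rightarrow> ('a \<Rightarrow> real) \<Rightarrow> ('a \<Rightarrow> real) \<Rightarrow> ('a \<Rightarrow> real) \<Rightarrow> real" where
  "closed_form b m f g =
     (THE q. \<forall>\<phi> \<psi>. form_approx b m \<phi> f \<longrightarrow> form_approx b m \<psi> g \<longrightarrow>
        (\<lambda>n. energy b (\<phi> n) (\<psi> n)) \<longlonglongrightarrow> q)"

text \<open>An unbounded operator is represented by its graph: \<open>(f, h) \<in> laplacian b m\<close> means that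
  \<open>f\<close> is in the domain of the operator and is mapped to \<open>h\<close>.\<close>

definition laplacian ::
  "('a \<Rightarrow> 'a \<Rightarrow> real) \<Rightarrow> ('a \<Rightarrow> real) \<Rightarrow> (('a \<Rightarrow> real) \<times> ('a \<Rightarrow> real)) set" where
  "laplacian b m =
     {(f, h). f \<in> form_domain b m \<and> h \<in> l2 m \<and>
        (\<forall>g\<in>form_domain b m. closed_form b m f g = l2_inner m h g)}"

section \<open>The heat semigroup\<close>

definition strongly_continuous_semigroup ::
  "('a \<Rightarrow> real) \<Rightarrow> (real \<Rightarrow> ('a \<Rightarrow> real) \<Rightarrow> 'a \<Rightarrow> real) \<Rightarrow> bool" where
  "strongly_continuous_semigroup m P \<longleftrightarrow>
     (\<forall>t\<ge>0. \<forall>f\<in>l2 m. P t f \<in> l2 m) \<and>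
     (\<forall>t\<ge>0. \<forall>f\<in>l2 m. \<forall>g\<in>l2 m. \<forall>c d.
        P t (\<lambda>x. c * f x + d * g x) = (\<lambda>x. c * P t f x + d * P t g x)) \<and>
     (\<forall>t\<ge>0. \<exists>C. \<forall>f\<in>l2 m. l2_norm m (P t f) \<le> C * l2_norm m f) \<and>
     (\<forall>f\<in>l2 m. P 0 f = f) \<and>
     (\<forall>s\<ge>0. \<forall>t\<ge>0. \<forall>f\<in>l2 m. P (s + t) f = P s (P t f)) \<and>
     (\<forall>f\<in>l2 m. ((\<lambda>t. l2_norm m (\<lambda>x. P t f x - f x)) \<longlongrightarrow> 0) (at_right 0))"

definition generator ::
  "('a \<Rightarrow> real) \<Rightarrow> (real \<Rightarrow> ('a \<Rightarrow> real) \<Rightarrow> 'a \<Rightarrow> real) \<Rightarrow> (('a \<Rightarrow> real) \<times> ('a \<Rightarrow> real)) set" where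
  "generator m P =
     {(f, g). f \<in> l2 m \<and> g \<in> l2 m \<and>
        ((\<lambda>t. l2_norm m (\<lambda>x. (P t f x - f x) / t - g x)) \<longlongrightarrow> 0) (at_right 0)}"

text \<open>\<open>exp (- t \<Delta>)\<close> is the strongly continuous semigroup on \<open>l2 m\<close> generated by \<open>- \<Delta>\<close>. The
  operators are uniquely determined on \<open>l2 m\<close> for \<open>t \<ge> 0\<close>; the choice only concerns the
  irrelevant values elsewhere.\<close>

definition heat_semigroup ::
  "('a \<Rightarrow> 'a \<Rightarrow> real) \<Rightarrow> ('a \<Rightarrow> real) \<Rightarrow> real \<Rightarrow> ('a \<Rightarrow> real) \<Rightarrow> 'a \<Rightarrow> real" where
  "heat_semigroup b m =
     (SOME P. strongly_continuous_semigroup m P \<and>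
        generator m P = {(f, \<lambda>x. - h x) | f h. (f, h) \<in> laplacian b m})"

text \<open>The kernel with respect to \<open>m\<close>: applying \<open>P\<^sub>t f x = (\<Sum>y. p\<^sub>t x y * f y * m y)\<close> to the
  indicator function of \<open>{y}\<close> determines \<open>p\<^sub>t x y\<close>.\<close>

definition heat_kernel ::
  "('a \<Rightarrow> 'a \<Rightarrow> real) \<Rightarrow> ('a \<Rightarrow> real) \<Rightarrow> real \<Rightarrow> 'a \<Rightarrow> 'a \<Rightarrow> real" where
  "heat_kernel b m t x y = heat_semigroup b m t (indicator {y}) x / m y"

text \<open>The action on bounded functions, which need not lie in \<open>l2 m\<close>.\<close>

definition heat_action ::
  "('a \<Rightarrow> 'a \<Rightarrow> real) \<Rightarrow> ('a \<Rightarrow> real) \<Rightarrow> real \<Rightarrow> ('a \<Rightarrow> real) \<Rightarrow> 'a \<Rightarrow> real" where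
  "heat_action b m t f x = (\<Sum>\<^sub>\<infinity>y. heat_kernel b m t x y * f y * m y)"

definition feller :: "('a \<Rightarrow> 'a \<Rightarrow> real) \<Rightarrow> ('a \<Rightarrow> real) \<Rightarrow> bool" where
  "feller b m \<longleftrightarrow>
     (\<forall>t\<ge>0. \<forall>f\<in>vanishing_at_infinity. heat_action b m t f \<in> vanishing_at_infinity)"

end

theory Submission
  imports Defs
begin

text \<open>
  The Feller property follows from two facts about the heat semigroup. A lower bound on the vertex
  measure makes every function in \<open>l2 m\<close> vanish at infinity, and the semigroup maps finitely
  supported functions into \<open>l2 m\<close>. The semigroup contracts the sup norm, equivalently the rows of
  its kernel have total mass at most \<open>1\<close>; so its action on uniform limits of finitely supported
  functions stays within their closure.

  The work lies in making the semigroup available, since it is specified only as some semigroup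
  generated by the negative of the Friedrichs extension. Three ingredients are needed.

  \<^item> Existence and uniqueness of a semigroup with a given m-dissipative generator. It is obtained as
  the limit of the implicit Euler scheme \<open>J\<^sub>t\<^sub>/\<^sub>n\<^sup>n\<close> built from the resolvents
  (\<open>P_tendsto\<close>, \<open>generator_P\<close>). Any other semigroup with this generator agrees with the same
  limit (\<open>C0_semigroup_unique\<close>). All estimates rest on the second order comparison
  \<open>J_J_near_J\<close> and on telescoping.

  \<^item> The resolvents of the Friedrichs extension. They solve a minimization problem for the
  functional \<open>c * E v v + (norm (v - g))\<^sup>2\<close>, and minimizing sequences over the original domain
  converge in the form norm (\<open>minimizing_sequence_limit\<close>).

  \<^item> Sup norm contraction. If \<open>\<bar>g\<bar> \<le> C\<close>, truncating at level \<open>C\<close> lowers the functional, so the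
  minimizer is bounded by \<open>C\<close> as well. The bound is inherited by the Euler products and by their
  limit (\<open>friedrichs_resolvent_in_closed\<close>, \<open>heat_semigroup_sup_contraction\<close>).
\<close>

section \<open>Strongly continuous semigroups on a Banach space\<close>

definition C0_semigroup :: "(real \<Rightarrow> 'a \<Rightarrow> 'a::real_normed_vector) \<Rightarrow> bool" where
  "C0_semigroup T \<longleftrightarrow>
     (\<forall>t\<ge>0. bounded_linear (T t)) \<and>
     (\<forall>x. T 0 x = x) \<and>
     (\<forall>s\<ge>0. \<forall>t\<ge>0. \<forall>x. T (s + t) x = T s (T t x)) \<and>
     (\<forall>x. ((\<lambda>t. T t x) \<longlongrightarrow> x) (at_right 0))"

definition infinitesimal_generator :: "(real \<Rightarrow> 'a \<Rightarrow> 'a::real_normed_vector) \<Rightarrow> ('a \<times> 'a) set" where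
  "infinitesimal_generator T = {(x, y). ((\<lambda>t. (T t x - x) /\<^sub>R t) \<longlongrightarrow> y) (at_right 0)}"

lemma C0_semigroup_power:
  assumes "C0_semigroup T" "t \<ge> 0"
  shows "(T t ^^ n) x = T (of_nat n * t) x"
proof (induction n)
  case (Suc n)
  have "T (t + of_nat n * t) x = T t (T (of_nat n * t) x)"
    using assms by (simp add: C0_semigroup_def)
  with Suc show ?case by (simp add: distrib_right)
qed (use assms in \<open>simp add: C0_semigroup_def\<close>)

text \<open>The sets \<open>G k\<close> of points whose orbit on \<open>[0, 1 / (k + 1)]\<close> stays below \<open>k\<close> are closed and, by
  continuity at \<open>0\<close>, cover the space; by Baire one of them contains a ball. This is the uniform
  boundedness principle, applied to a whole time interval at once.\<close>

lemma C0_semigroup_bounded_near_0: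
  fixes T :: "real \<Rightarrow> 'a \<Rightarrow> 'a::banach"
  assumes T: "C0_semigroup T"
  obtains d M where "d > 0" "M \<ge> 1" "\<And>t x. 0 \<le> t \<Longrightarrow> t \<le> d \<Longrightarrow> norm (T t x) \<le> M * norm x"
proof -
  have lin: "bounded_linear (T t)" if "t \<ge> 0" for t
    using T that by (simp add: C0_semigroup_def)
  define G where "G = (\<lambda>k::nat. {x. \<forall>t\<in>{0..1 / Suc k}. norm (T t x) \<le> k})"
  have closed: "closed (G k)" for k
  proof -
    have "G k = (\<Inter>t\<in>{0..1 / Suc k}. {x. norm (T t x) \<le> k})" by (auto simp: G_def)
    also have "closed \<dots>"
      by (intro closed_INT ballI closed_Collect_le continuous_intros
          bounded_linear.continuous_on[OF lin]) auto
    finally show ?thesis .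
  qed
  have "x \<in> \<Union>(range G)" for x
  proof -
    have "((\<lambda>t. norm (T t x)) \<longlongrightarrow> norm x) (at_right 0)"
      using T by (intro tendsto_norm) (simp add: C0_semigroup_def)
    then have "eventually (\<lambda>t. norm (T t x) < norm x + 1) (at_right 0)"
      by (rule order_tendstoD) simp
    then obtain e where e: "e > 0" "\<And>t. 0 < t \<Longrightarrow> t < e \<Longrightarrow> norm (T t x) < norm x + 1"
      by (auto simp: eventually_at_right_field)
    obtain k :: nat where k: "k > max (norm x + 1) (1 / e)" using reals_Archimedean2 by blast
    have "1 / e < Suc k" using k by simp
    then have ek: "1 / Suc k < e" using e(1) by (simp add: field_simps)
    have "norm (T t x) \<le> k" if "t \<in> {0..1 / Suc k}" for t
    proof (cases "t = 0")
      case True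
      then show ?thesis using k T by (simp add: C0_semigroup_def)
    next
      case False
      then show ?thesis using that ek e(2)[of t] k by auto
    qed
    then have "x \<in> G k" by (simp add: G_def)
    then show ?thesis by blast
  qed
  then have UN: "\<Union>(range G) = UNIV" by auto
  have "\<exists>k. interior (G k) \<noteq> {}"
  proof (rule ccontr)
    assume "\<not> ?thesis"
    then have "euclidean interior_of \<Union>(range G) = {}"
      using closed
      by (intro Baire_category_alt disjI1) (auto simp: completely_metrizable_space_euclidean)
    with UN show False by simp
  qed
  then obtain k a where "a \<in> interior (G k)" by auto
  then obtain r where r: "r > 0" "cball a r \<subseteq> G k"
    by (meson interior_subset open_contains_cball open_interior subset_trans)
  show thesis
  proof
    show "1 / Suc k > (0::real)" by simp
    show "max 1 (2 * k / r) \<ge> (1::real)" by simp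
    fix t x assume t: "0 \<le> t" "t \<le> 1 / Suc k"
    have *: "norm (T t y) \<le> k" if "y \<in> cball a r" for y
      using r that t by (auto simp: G_def)
    show "norm (T t x) \<le> max 1 (2 * k / r) * norm x"
    proof (cases "x = 0")
      case True
      then show ?thesis using linear_0[OF bounded_linear.linear[OF lin[OF t(1)]]] by simp
    next
      case False
      \<comment> \<open>\<open>x\<close>, rescaled, is the difference of two points of the ball\<close>
      define y where "y = a + (r / norm x) *\<^sub>R x"
      have "norm (T t (y - a)) \<le> norm (T t y) + norm (T t a)"
        using bounded_linear.linear[OF lin[OF t(1)]] by (simp add: linear_diff norm_triangle_ineq4)
      also have "\<dots> \<le> 2 * k"
        using *[of y] *[of a] r False by (simp add: y_def dist_norm)
      also have "T t (y - a) = (r / norm x) *\<^sub>R T t x"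
        using bounded_linear.linear[OF lin[OF t(1)]] by (simp add: y_def linear_scale)
      finally have "r / norm x * norm (T t x) \<le> 2 * k" using r by simp
      then have "norm (T t x) \<le> 2 * k / r * norm x"
        using False r by (simp add: field_simps)
      also have "\<dots> \<le> max 1 (2 * k / r) * norm x" by (intro mult_right_mono) auto
      finally show ?thesis .
    qed
  qed
qed

text \<open>The uniqueness proof compares \<open>n\<close>-fold products, so it needs one bound for all
  \<open>T (k t / n)\<close> with \<open>k \<le> n\<close>.\<close>

lemma C0_semigroup_locally_bounded:
  fixes T :: "real \<Rightarrow> 'a \<Rightarrow> 'a::banach"
  assumes T: "C0_semigroup T"
  obtains M where "\<And>t x. 0 \<le> t \<Longrightarrow> t \<le> a \<Longrightarrow> norm (T t x) \<le> M * norm x"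
proof -
  obtain d M where d: "d > 0" and M: "M \<ge> 1"
    and bd: "\<And>t x. 0 \<le> t \<Longrightarrow> t \<le> d \<Longrightarrow> norm (T t x) \<le> M * norm x"
    using C0_semigroup_bounded_near_0[OF T] by metis
  obtain n :: nat where n: "a / d < n" using reals_Archimedean2 by blast
  define N where "N = Suc n"
  have pow: "norm ((T s ^^ k) x) \<le> M ^ k * norm x" if "0 \<le> s" "s \<le> d" for s k x
  proof (induction k)
    case (Suc k)
    have "norm ((T s ^^ Suc k) x) \<le> M * norm ((T s ^^ k) x)" using bd[OF that] by simp
    also have "\<dots> \<le> M * (M ^ k * norm x)" using Suc M by (intro mult_left_mono) auto
    finally show ?case by simp
  qed simp
  show thesis
  proof
    fix t x assume t: "0 \<le> t" "t \<le> a"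
    have "a < n * d" using n d by (simp add: field_simps)
    also have "\<dots> \<le> N * d" using d by (simp add: N_def)
    finally have "t / N \<le> d" using t by (simp add: N_def field_simps)
    then have "norm ((T (t / N) ^^ N) x) \<le> M ^ N * norm x" using t by (intro pow) auto
    also have "(T (t / N) ^^ N) x = T t x"
      using C0_semigroup_power[OF T, of "t / N" N x] t by (simp add: N_def)
    finally show "norm (T t x) \<le> M ^ N * norm x" .
  qed
qed

text \<open>Telescoping: replacing one factor of \<open>T ^^ n\<close> after the other by \<open>S\<close> costs at most
  \<open>M * norm (S x - T x)\<close> each time.\<close>

lemma norm_funpow_diff_le:
  fixes S T :: "'a \<Rightarrow> 'a::real_normed_vector"
  assumes S: "\<And>k x y. k \<le> n \<Longrightarrow> norm ((S ^^ k) x - (S ^^ k) y) \<le> M * norm (x - y)"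
    and T: "\<And>x y. norm (T x - T y) \<le> norm (x - y)"
    and comm: "\<And>x. S (T x) = T (S x)" and M: "M \<ge> 0"
  shows "norm ((S ^^ n) x - (T ^^ n) x) \<le> M * of_nat n * norm (S x - T x)"
  using S
proof (induction n arbitrary: x)
  case (Suc n)
  have "norm ((S ^^ Suc n) x - (T ^^ Suc n) x)
      = norm (((S ^^ n) (S x) - (S ^^ n) (T x)) + ((S ^^ n) (T x) - (T ^^ n) (T x)))"
    by (simp add: funpow_swap1)
  also have "\<dots> \<le> norm ((S ^^ n) (S x) - (S ^^ n) (T x)) + norm ((S ^^ n) (T x) - (T ^^ n) (T x))"
    by (rule norm_triangle_ineq)
  also have "norm ((S ^^ n) (S x) - (S ^^ n) (T x)) \<le> M * norm (S x - T x)"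
    using Suc.prems by simp
  also have "norm ((S ^^ n) (T x) - (T ^^ n) (T x)) \<le> M * of_nat n * norm (S (T x) - T (T x))"
    using Suc.prems by (intro Suc.IH) auto
  also have "\<dots> \<le> M * of_nat n * norm (S x - T x)"
    using T[of "S x" "T x"] M by (intro mult_left_mono) (auto simp: comm)
  finally show ?case by (simp add: algebra_simps)
qed (use assms in simp)

lemma Cauchy_of_dense:
  fixes F :: "nat \<Rightarrow> 'a \<Rightarrow> 'a::banach"
  assumes F: "\<And>n x y. norm (F n x - F n y) \<le> norm (x - y)"
    and D: "\<And>x. x \<in> D \<Longrightarrow> convergent (\<lambda>n. F n x)" and dense: "closure D = UNIV"
  shows "convergent (\<lambda>n. F n x)"
proof (rule Cauchy_convergent, rule CauchyI)
  fix e :: real assume e: "e > 0"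
  have "x \<in> closure D" using dense by simp
  then obtain y where y: "y \<in> D" "dist y x < e / 3"
    unfolding closure_approachable using e by (metis zero_less_divide_iff zero_less_numeral)
  have "Cauchy (\<lambda>n. F n y)" using D[OF y(1)] by (rule convergent_Cauchy)
  then obtain N where N: "\<And>i j. i \<ge> N \<Longrightarrow> j \<ge> N \<Longrightarrow> norm (F i y - F j y) < e / 3"
    using CauchyD[of "\<lambda>n. F n y" "e/3"] e by auto
  have "norm (F i x - F j x) < e" if "i \<ge> N" "j \<ge> N" for i j
  proof -
    have "norm (F i x - F j x) \<le> norm (F i x - F i y) + norm (F i y - F j y) + norm (F j x - F j y)"
      using dist_triangle[of "F i x" "F j x" "F i y"] dist_triangle[of "F i y" "F j x" "F j y"]
      by (simp add: dist_norm norm_minus_commute)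
    also have "\<dots> < e"
      using F[of i x y] F[of j x y] N[OF that] y(2) by (simp add: dist_norm norm_minus_commute)
    finally show ?thesis .
  qed
  then show "\<exists>M. \<forall>m\<ge>M. \<forall>n\<ge>M. norm (F m x - F n x) < e" by blast
qed

text \<open>The hypotheses of the Lumer-Phillips theorem. The operator is represented by its graph.\<close>

locale m_dissipative =
  fixes A :: "('a::banach \<times> 'a) set"
  assumes subspace_A: "subspace A"
    and dissipative: "(f, h) \<in> A \<Longrightarrow> c > 0 \<Longrightarrow> norm f \<le> norm (f - c *\<^sub>R h)"
    and range: "c > 0 \<Longrightarrow> \<exists>f h. (f, h) \<in> A \<and> f - c *\<^sub>R h = g"
    and dense: "closure (fst ` A) = UNIV"
begin

text \<open>The resolvent \<open>(1 - c A)\<^sup>-\<^sup>1\<close>, that is, one implicit Euler step of size \<open>c\<close>. The formula under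
  \<open>THE\<close> would leave \<open>J 0\<close> unspecified off the domain of \<open>A\<close>.\<close>

definition J :: "real \<Rightarrow> 'a \<Rightarrow> 'a" where
  "J c g = (if c = 0 then g else (THE f. \<exists>h. (f, h) \<in> A \<and> f - c *\<^sub>R h = g))"

lemma A_add: "(f, h) \<in> A \<Longrightarrow> (f', h') \<in> A \<Longrightarrow> (f + f', h + h') \<in> A"
  using subspace_add[OF subspace_A, of "(f, h)" "(f', h')"] by simp

lemma A_diff: "(f, h) \<in> A \<Longrightarrow> (f', h') \<in> A \<Longrightarrow> (f - f', h - h') \<in> A"
  using subspace_diff[OF subspace_A, of "(f, h)" "(f', h')"] by simp

lemma A_scale: "(f, h) \<in> A \<Longrightarrow> (r *\<^sub>R f, r *\<^sub>R h) \<in> A"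
  using subspace_scale[OF subspace_A, of "(f, h)" r] by simp

lemma resolvent_unique:
  assumes "(f, h) \<in> A" "(f', h') \<in> A" "c > 0" "f - c *\<^sub>R h = f' - c *\<^sub>R h'"
  shows "f = f'"
proof -
  have "f - f' - c *\<^sub>R (h - h') = 0" using assms(4) by (simp add: algebra_simps)
  with dissipative[OF A_diff[OF assms(1,2)] assms(3)] show ?thesis by simp
qed

lemma J_eq:
  assumes "(f, h) \<in> A" "c \<ge> 0"
  shows "J c (f - c *\<^sub>R h) = f"
proof (cases "c = 0")
  case False
  have "(THE f'. \<exists>h'. (f', h') \<in> A \<and> f' - c *\<^sub>R h' = f - c *\<^sub>R h) = f"
    using assms False resolvent_unique[of _ _ f h c] by (intro the_equality) auto
  with False show ?thesis by (simp add: J_def)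
qed (simp add: J_def)

lemma J_0 [simp]: "J 0 g = g"
  by (simp add: J_def)

lemma J_cases:
  assumes "c > 0"
  obtains h where "(J c g, h) \<in> A" "J c g - c *\<^sub>R h = g"
  using range[OF assms, of g] J_eq assms by (metis less_imp_le)

lemma J_add: "c \<ge> 0 \<Longrightarrow> J c (f + g) = J c f + J c g"
proof (cases "c = 0")
  case False
  assume "c \<ge> 0"
  with False have c: "c > 0" by simp
  obtain h h' where h: "(J c f, h) \<in> A" "J c f - c *\<^sub>R h = f" "(J c g, h') \<in> A" "J c g - c *\<^sub>R h' = g"
    using J_cases[OF c] by metis
  have "f + g = (J c f + J c g) - c *\<^sub>R (h + h')"
    using h by (simp add: algebra_simps)
  then show ?thesis using J_eq[OF A_add[OF h(1,3)], of c] c by simp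
qed simp

lemma J_scale: "c \<ge> 0 \<Longrightarrow> J c (r *\<^sub>R f) = r *\<^sub>R J c f"
proof (cases "c = 0")
  case False
  assume "c \<ge> 0"
  with False have c: "c > 0" by simp
  obtain h where h: "(J c f, h) \<in> A" "J c f - c *\<^sub>R h = f"
    using J_cases[OF c] by metis
  have "r *\<^sub>R f = r *\<^sub>R J c f - c *\<^sub>R (r *\<^sub>R h)"
    by (subst h(2)[symmetric]) (simp add: algebra_simps)
  then show ?thesis using J_eq[OF A_scale[OF h(1), of r], of c] c by simp
qed simp

lemma J_norm: "c \<ge> 0 \<Longrightarrow> norm (J c g) \<le> norm g"
proof (cases "c = 0")
  case False
  assume "c \<ge> 0"
  with False have c: "c > 0" by simp
  obtain h where h: "(J c g, h) \<in> A" "J c g - c *\<^sub>R h = g"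
    using J_cases[OF c] by metis
  with dissipative[OF h(1) c] show ?thesis by simp
qed simp

lemma J_diff: "c \<ge> 0 \<Longrightarrow> J c (f - g) = J c f - J c g"
  using J_add[of c "f - g" g] by simp

text \<open>Resolvents commute with the operator, because \<open>h' = (J c f - f) / c\<close> itself solves the resolvent
  equation for \<open>h\<close>.\<close>

lemma J_A:
  assumes "(f, h) \<in> A" "c \<ge> 0"
  shows "(J c f, J c h) \<in> A" and "J c f - f = c *\<^sub>R J c h"
proof -
  have "(J c f, J c h) \<in> A \<and> J c f - f = c *\<^sub>R J c h"
  proof (cases "c = 0")
    case False
    with assms have c: "c > 0" by simp
    obtain h' where h': "(J c f, h') \<in> A" "J c f - c *\<^sub>R h' = f"
      using J_cases[OF c] by metis
    have eq: "J c f - f = c *\<^sub>R h'" using h'(2) by (metis add_diff_cancel_left' diff_add_cancel)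
    have "((1 / c) *\<^sub>R (J c f - f), (1 / c) *\<^sub>R (h' - h)) \<in> A"
      by (intro A_scale A_diff h' assms)
    then have "(h', (1 / c) *\<^sub>R (h' - h)) \<in> A" using eq c by simp
    from J_eq[OF this, of c] c have "J c h = h'" by simp
    with h' eq show ?thesis by simp
  qed (use assms in simp)
  then show "(J c f, J c h) \<in> A" and "J c f - f = c *\<^sub>R J c h" by auto
qed

lemma J_commute:
  assumes "c \<ge> 0" "d \<ge> 0"
  shows "J c (J d g) = J d (J c g)"
proof (cases "c = 0")
  case False
  with assms have c: "c > 0" by simp
  obtain h where h: "(J c g, h) \<in> A" "J c g - c *\<^sub>R h = g"
    using J_cases[OF c] by metis
  have "J d g = J d (J c g) - c *\<^sub>R J d h"
    using h(2) assms by (metis J_diff J_scale)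
  then show ?thesis using J_eq[OF J_A(1)[OF h(1) assms(2)] assms(1)] by simp
qed simp

lemma norm_J_diff_le:
  assumes "(f, h) \<in> A" "c \<ge> 0"
  shows "norm (J c f - f) \<le> c * norm h"
  using J_A(2)[OF assms] J_norm[OF assms(2), of h] assms(2) by (simp add: mult_left_mono)

lemma J_tendsto: "((\<lambda>c. J c g) \<longlongrightarrow> g) (at_right 0)"
proof (rule tendstoI)
  fix e :: real assume e: "e > 0"
  have "g \<in> closure (fst ` A)" using dense by simp
  then obtain f h where f: "(f, h) \<in> A" "dist f g < e / 3"
    unfolding closure_approachable using e
    by (metis (no_types, lifting) image_iff prod.collapse zero_less_divide_iff zero_less_numeral)
  define d where "d = e / (3 * (norm h + 1))"
  have d: "d > 0" using e by (simp add: d_def add_nonneg_pos)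
  have "dist (J c g) g < e" if "0 < c" "c < d" for c
  proof -
    have "dist (J c g) g \<le> norm (J c (g - f)) + norm (J c f - f) + norm (f - g)"
      using that J_diff[of c g f]
      by (smt (verit, del_insts) dist_norm norm_triangle_ineq add_diff_eq diff_add_cancel)
    also have "norm (J c (g - f)) \<le> norm (g - f)" using that by (intro J_norm) auto
    also have "norm (J c f - f) \<le> c * norm h" using that by (intro norm_J_diff_le f) auto
    also have "c * norm h \<le> d * (norm h + 1)" using that d by (intro mult_mono) auto
    also have "\<dots> = e / 3" by (simp add: d_def add_nonneg_eq_0_iff divide_simps)
    finally show ?thesis using f(2) by (simp add: dist_norm norm_minus_commute)
  qed
  then show "\<forall>\<^sub>F c in at_right 0. dist (J c g) g < e"
    using d by (auto simp: eventually_at_right_field)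
qed

text \<open>The domain of \<open>A\<^sup>2\<close>, on which Euler steps have an error of second order.\<close>

definition domain2 :: "'a set" where
  "domain2 = {f. \<exists>h k. (f, h) \<in> A \<and> (h, k) \<in> A}"

lemma J_domain2:
  assumes "(f, h) \<in> A" "c > 0"
  obtains k where "(J c f, J c h) \<in> A" "(J c h, k) \<in> A"
  using J_A[OF assms(1)] J_cases[OF assms(2), of h] assms(2) by (metis less_imp_le)

lemma dense_domain2: "closure domain2 = UNIV"
proof -
  have "f \<in> closure domain2" if "(f, h) \<in> A" for f h
  proof -
    have "\<exists>y\<in>domain2. dist y f < e" if "e > 0" for e
    proof -
      have "eventually (\<lambda>c. dist (J c f) f < e) (at_right 0)"
        using J_tendsto that by (rule tendstoD)
      then obtain d where d: "d > 0" "\<And>c. 0 < c \<Longrightarrow> c < d \<Longrightarrow> dist (J c f) f < e"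
        by (auto simp: eventually_at_right_field)
      have c: "0 < d / 2" "d / 2 < d" using d by auto
      obtain k where "(J (d / 2) f, J (d / 2) h) \<in> A" "(J (d / 2) h, k) \<in> A"
        using J_domain2[OF \<open>(f, h) \<in> A\<close> c(1)] .
      then have "J (d / 2) f \<in> domain2" by (auto simp: domain2_def)
      with d(2)[OF c] show ?thesis by blast
    qed
    then show ?thesis by (auto simp: closure_approachable)
  qed
  then have "fst ` A \<subseteq> closure domain2" by auto
  then have "closure (fst ` A) \<subseteq> closure domain2" by (simp add: closure_minimal)
  with dense show ?thesis by auto
qed

text \<open>On the domain of \<open>A\<^sup>2\<close> one has
  \<open>J\<^sub>a J\<^sub>b - J\<^sub>a\<^sub>+\<^sub>b = J\<^sub>a J\<^sub>b J\<^sub>a\<^sub>+\<^sub>b ((1 - (a + b) A) - (1 - a A) (1 - b A)) = - a b J\<^sub>a J\<^sub>b J\<^sub>a\<^sub>+\<^sub>b A\<^sup>2\<close>.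
  This estimate gives both the convergence of the Euler scheme and the semigroup law.\<close>

lemma J_J_near_J:
  assumes A: "(f, h) \<in> A" "(h, k) \<in> A" and ab: "a \<ge> 0" "b \<ge> 0"
  shows "norm (J a (J b f) - J (a + b) f) \<le> a * b * norm k"
proof -
  let ?R = "J (a + b)"
  have R: "(?R f, ?R h) \<in> A" "(?R h, ?R k) \<in> A" using A ab by (auto intro!: J_A)
  have f: "f = (?R f - b *\<^sub>R ?R h) - a *\<^sub>R ?R h"
    using J_A(2)[OF A(1), of "a + b"] ab by (simp add: algebra_simps)
  have "J b (?R f - b *\<^sub>R ?R h) = ?R f" by (intro J_eq R ab)
  moreover have "J b (?R h) - ?R h = b *\<^sub>R J b (?R k)" by (intro J_A R ab)
  moreover have "J b f = J b (?R f - b *\<^sub>R ?R h) - a *\<^sub>R J b (?R h)"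
    by (subst f) (simp only: J_diff J_scale ab)
  moreover have "J b (?R h) = ?R h + b *\<^sub>R J b (?R k)" using calculation(2) by (simp add: algebra_simps)
  ultimately have "J b f = ?R f - a *\<^sub>R (?R h + b *\<^sub>R J b (?R k))" by simp
  also have "\<dots> = (?R f - a *\<^sub>R ?R h) - (a * b) *\<^sub>R J b (?R k)" by (simp add: algebra_simps)
  finally have "J a (J b f) = J a (?R f - a *\<^sub>R ?R h) - (a * b) *\<^sub>R J a (J b (?R k))"
    by (simp add: J_diff J_scale ab)
  also have "J a (?R f - a *\<^sub>R ?R h) = ?R f" by (intro J_eq R ab)
  finally have "norm (J a (J b f) - ?R f) = a * b * norm (J a (J b (?R k)))" using ab by simp
  also have "norm (J a (J b (?R k))) \<le> norm k"
    using J_norm ab by (meson order_trans add_nonneg_nonneg)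
  finally show ?thesis using ab by (simp add: mult_left_mono)
qed

lemma J_power_near_J:
  assumes A: "(f, h) \<in> A" "(h, k) \<in> A" and c: "c \<ge> 0"
  shows "norm ((J c ^^ n) f - J (n * c) f) \<le> (n * c)\<^sup>2 * norm k"
proof (induction n)
  case (Suc n)
  have "norm ((J c ^^ Suc n) f - J (Suc n * c) f)
      \<le> norm (J c ((J c ^^ n) f - J (n * c) f)) + norm (J c (J (n * c) f) - J (c + n * c) f)"
    using norm_triangle_ineq[of "J c ((J c ^^ n) f - J (n * c) f)" "J c (J (n * c) f) - J (c + n * c) f"] c
    by (simp add: J_diff distrib_right)
  also have "norm (J c ((J c ^^ n) f - J (n * c) f)) \<le> (n * c)\<^sup>2 * norm k"
    using Suc J_norm[OF c] order_trans by blast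
  also have "norm (J c (J (n * c) f) - J (c + n * c) f) \<le> c * (n * c) * norm k"
    using A c by (intro J_J_near_J) auto
  also have "(n * c)\<^sup>2 * norm k + c * (n * c) * norm k \<le> (Suc n * c)\<^sup>2 * norm k"
    unfolding distrib_right[symmetric]
    by (intro mult_right_mono) (use c in \<open>auto simp: power2_eq_square algebra_simps\<close>)
  finally show ?case by simp
qed simp

lemma J_power_diff: "c \<ge> 0 \<Longrightarrow> (J c ^^ n) (x - y) = (J c ^^ n) x - (J c ^^ n) y"
  by (induction n) (auto simp: J_diff)

lemma J_power_add: "c \<ge> 0 \<Longrightarrow> (J c ^^ n) (x + y) = (J c ^^ n) x + (J c ^^ n) y"
  by (induction n) (auto simp: J_add)

lemma J_power_scale: "c \<ge> 0 \<Longrightarrow> (J c ^^ n) (r *\<^sub>R x) = r *\<^sub>R (J c ^^ n) x"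
  by (induction n) (auto simp: J_scale)

lemma J_power_norm: "c \<ge> 0 \<Longrightarrow> norm ((J c ^^ n) x) \<le> norm x"
  by (induction n) (auto intro: order_trans[OF J_norm])

lemma J_power_commute:
  assumes "c \<ge> 0" "d \<ge> 0"
  shows "J c ((J d ^^ n) x) = (J d ^^ n) (J c x)"
proof (induction n)
  case (Suc n)
  then show ?case using J_commute[OF assms, of "(J d ^^ n) x"] by simp
qed simp

text \<open>Both step sizes \<open>t / n\<close> and \<open>t / m\<close> are compared with their common refinement \<open>t / (n m)\<close>.\<close>

lemma euler_refinement:
  assumes A: "(f, h) \<in> A" "(h, k) \<in> A" and t: "t \<ge> 0" and nm: "n > 0" "m > 0"
  shows "norm ((J (t / n) ^^ n) f - (J (t / m) ^^ m) f) \<le> t\<^sup>2 * (1 / n + 1 / m) * norm k"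
proof -
  have refine: "norm ((J (t / (n * m)) ^^ (n * m)) f - (J (t / n) ^^ n) f) \<le> t\<^sup>2 / n * norm k"
    if "n > 0" "m > 0" for n m :: nat
  proof -
    let ?c = "t / (n * m)"
    have c: "?c \<ge> 0" using t by simp
    have tn: "m * ?c = t / n" using that by simp
    have "norm (((J ?c ^^ m) ^^ n) f - (J (t / n) ^^ n) f)
        \<le> 1 * of_nat n * norm ((J ?c ^^ m) f - J (t / n) f)"
    proof (rule norm_funpow_diff_le)
      show "norm (((J ?c ^^ m) ^^ k) x - ((J ?c ^^ m) ^^ k) y) \<le> 1 * norm (x - y)" for k x y
        unfolding funpow_mult J_power_diff[OF c, symmetric] using J_power_norm[OF c] by simp
      show "norm (J (t / n) x - J (t / n) y) \<le> norm (x - y)" for x y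
        using t by (simp add: J_norm flip: J_diff)
      show "(J ?c ^^ m) (J (t / n) x) = J (t / n) ((J ?c ^^ m) x)" for x
        using t by (simp add: J_power_commute)
    qed simp
    also have "(J ?c ^^ m) ^^ n = J ?c ^^ (n * m)" by (simp add: funpow_mult mult.commute)
    also have "norm ((J ?c ^^ m) f - J (t / n) f) \<le> (t / n)\<^sup>2 * norm k"
      using J_power_near_J[OF A c, of m] unfolding tn .
    then have "1 * of_nat n * norm ((J ?c ^^ m) f - J (t / n) f) \<le> of_nat n * ((t / n)\<^sup>2 * norm k)"
      by (simp add: mult_left_mono)
    also have "\<dots> = t\<^sup>2 / n * norm k" using that by (simp add: power2_eq_square)
    finally show ?thesis .
  qed
  have "norm ((J (t / n) ^^ n) f - (J (t / m) ^^ m) f)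
     \<le> norm ((J (t / (n * m)) ^^ (n * m)) f - (J (t / n) ^^ n) f)
        + norm ((J (t / (n * m)) ^^ (n * m)) f - (J (t / m) ^^ m) f)"
    using dist_triangle3[of "(J (t / n) ^^ n) f" "(J (t / m) ^^ m) f" "(J (t / (n * m)) ^^ (n * m)) f"]
    by (simp add: dist_norm)
  also have "\<dots> \<le> t\<^sup>2 / n * norm k + t\<^sup>2 / m * norm k"
    using refine[of n m] refine[of m n] nm by (intro add_mono) (auto simp: mult.commute)
  finally show ?thesis by (simp add: algebra_simps)
qed

text \<open>The exponential formula for the semigroup generated by \<open>A\<close>.\<close>

definition P :: "real \<Rightarrow> 'a \<Rightarrow> 'a" where
  "P t f = lim (\<lambda>n. (J (t / of_nat n) ^^ n) f)"

lemma P_tendsto: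
  assumes t: "t \<ge> 0"
  shows "(\<lambda>n. (J (t / of_nat n) ^^ n) f) \<longlonglongrightarrow> P t f"
proof -
  have "convergent (\<lambda>n. (J (t / of_nat n) ^^ n) f)"
  proof (rule Cauchy_of_dense[OF _ _ dense_domain2])
    show "norm ((J (t / real n) ^^ n) x - (J (t / real n) ^^ n) y) \<le> norm (x - y)" for n x y
      using t by (simp add: J_power_norm flip: J_power_diff)
    fix x assume "x \<in> domain2"
    then obtain h k where A: "(x, h) \<in> A" "(h, k) \<in> A" by (auto simp: domain2_def)
    show "convergent (\<lambda>n. (J (t / real n) ^^ n) x)"
    proof (rule Cauchy_convergent, rule CauchyI)
      fix e :: real assume e: "e > 0"
      obtain N :: nat where N: "N > 2 * t\<^sup>2 * norm k / e" using reals_Archimedean2 by blast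
      have "2 * t\<^sup>2 * norm k / e \<ge> 0" using e by simp
      then have N0: "N > 0" using N by (smt (verit) of_nat_0_less_iff)
      have "norm ((J (t / i) ^^ i) x - (J (t / j) ^^ j) x) < e" if "i \<ge> N" "j \<ge> N" for i j :: nat
      proof -
        have "norm ((J (t / i) ^^ i) x - (J (t / j) ^^ j) x) \<le> t\<^sup>2 * (1 / i + 1 / j) * norm k"
          using that N0 by (intro euler_refinement[OF A t]) auto
        also have "\<dots> \<le> t\<^sup>2 * (1 / N + 1 / N) * norm k"
          using that N0 by (intro mult_right_mono mult_left_mono add_mono divide_left_mono) auto
        also have "\<dots> < e" using N N0 e by (simp add: field_simps)
        finally show ?thesis .
      qed
      then show "\<exists>M. \<forall>m\<ge>M. \<forall>n\<ge>M. norm ((J (t / real m) ^^ m) x - (J (t / real n) ^^ n) x) < e"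
        by blast
    qed
  qed
  then show ?thesis by (simp add: P_def convergent_LIMSEQ_iff)
qed

text \<open>Whatever the resolvents preserve survives in the limit of the Euler scheme.\<close>

lemma P_in_closed:
  assumes K: "closed K" and J: "\<And>c g. c > 0 \<Longrightarrow> g \<in> K \<Longrightarrow> J c g \<in> K" and "t \<ge> 0" "g \<in> K"
  shows "P t g \<in> K"
proof (rule closed_sequentially[OF K _ P_tendsto[OF \<open>t \<ge> 0\<close>]])
  show "(J (t / real n) ^^ n) g \<in> K" for n
  proof -
    have "J c g' \<in> K" if "c \<ge> 0" "g' \<in> K" for c g'
      using that J by (cases "c = 0") auto
    then have "(J (t / real n) ^^ i) g \<in> K" for i using assms by (induction i) auto
    then show ?thesis .
  qed
qed

lemma P_norm: "t \<ge> 0 \<Longrightarrow> norm (P t f) \<le> norm f"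
  by (rule LIMSEQ_le_const2[OF tendsto_norm[OF P_tendsto]]) (simp_all add: J_power_norm)

lemma P_add: "t \<ge> 0 \<Longrightarrow> P t (f + g) = P t f + P t g"
  using tendsto_add[OF P_tendsto P_tendsto, of t t f g] P_tendsto[of t "f + g"]
  by (simp add: J_power_add) (rule LIMSEQ_unique)

lemma P_scale: "t \<ge> 0 \<Longrightarrow> P t (r *\<^sub>R f) = r *\<^sub>R P t f"
  using tendsto_scaleR[OF tendsto_const P_tendsto, of t r f] P_tendsto[of t "r *\<^sub>R f"]
  by (simp add: J_power_scale) (rule LIMSEQ_unique)

lemma P_diff: "t \<ge> 0 \<Longrightarrow> P t (f - g) = P t f - P t g"
  using P_add[of t "f - g" g] by simp

lemma bounded_linear_P: "t \<ge> 0 \<Longrightarrow> bounded_linear (P t)"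
  by (rule bounded_linear_intro[where K = 1]) (auto simp: P_add P_scale P_norm)

lemma P_0: "P 0 f = f"
proof -
  have "(J 0 ^^ n) f = f" for n by (induction n) auto
  then show ?thesis using P_tendsto[of 0 f] by (simp add: LIMSEQ_const_iff)
qed

text \<open>By commutation \<open>J\<^sub>s\<^sub>/\<^sub>n\<^sup>n J\<^sub>t\<^sub>/\<^sub>n\<^sup>n = (J\<^sub>s\<^sub>/\<^sub>n J\<^sub>t\<^sub>/\<^sub>n)\<^sup>n\<close>, and each of the \<open>n\<close> factors differs from
  the Euler step of size \<open>(s + t) / n\<close> by \<open>O (1 / n\<^sup>2)\<close>.\<close>

lemma P_semigroup:
  assumes st: "s \<ge> 0" "t \<ge> 0"
  shows "P (s + t) f = P s (P t f)"
proof -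
  define S where "S = {f. P (s + t) f = P s (P t f)}"
  have "f \<in> S" if "f \<in> domain2" for f
  proof -
    obtain h k where A: "(f, h) \<in> A" "(h, k) \<in> A" using \<open>f \<in> domain2\<close> by (auto simp: domain2_def)
    let ?E = "\<lambda>t n. J (t / of_nat n) ^^ n"
    have "norm (?E s n (?E t n f) - ?E (s + t) n f) \<le> s * t * norm k / n" if "n > 0" for n :: nat
    proof -
      let ?Q = "\<lambda>x. J (s / n) (J (t / n) x)"
      have Q: "(?Q ^^ i) x = (J (s / n) ^^ i) ((J (t / n) ^^ i) x)" for i x
      proof (induction i)
        case (Suc i)
        then have "(?Q ^^ Suc i) x = J (s / n) (J (t / n) ((J (s / n) ^^ i) ((J (t / n) ^^ i) x)))"
          by simp
        then show ?case using st by (simp add: J_power_commute)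
      qed simp
      have "norm ((?Q ^^ n) f - (J ((s + t) / n) ^^ n) f)
          \<le> 1 * of_nat n * norm (?Q f - J ((s + t) / n) f)"
      proof (rule norm_funpow_diff_le)
        show "norm ((?Q ^^ k) x - (?Q ^^ k) y) \<le> 1 * norm (x - y)" for k x y
        proof -
          have "norm ((?Q ^^ k) x - (?Q ^^ k) y) = norm ((J (s / n) ^^ k) ((J (t / n) ^^ k) (x - y)))"
            unfolding Q using st by (simp add: J_power_diff)
          also have "\<dots> \<le> norm ((J (t / n) ^^ k) (x - y))" using st by (intro J_power_norm) simp
          also have "\<dots> \<le> norm (x - y)" using st by (intro J_power_norm) simp
          finally show ?thesis by simp
        qed
        show "norm (J ((s + t) / n) x - J ((s + t) / n) y) \<le> norm (x - y)" for x y
          using st by (simp add: J_norm flip: J_diff)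
        show "?Q (J ((s + t) / n) x) = J ((s + t) / n) (?Q x)" for x
          using st J_commute by simp
      qed simp
      also have "norm (?Q f - J ((s + t) / n) f) \<le> s / n * (t / n) * norm k"
        using J_J_near_J[OF A, of "s / n" "t / n"] st by (simp add: add_divide_distrib)
      then have "1 * of_nat n * norm (?Q f - J ((s + t) / n) f) \<le> of_nat n * (s / n * (t / n) * norm k)"
        unfolding mult_1 by (intro mult_left_mono) auto
      also have "\<dots> = s * t * norm k / n" using that by simp
      finally show ?thesis by (simp add: Q)
    qed
    then have "(\<lambda>n. ?E s n (?E t n f) - ?E (s + t) n f) \<longlonglongrightarrow> 0"
      by (intro Lim_null_comparison[OF _ lim_const_over_n[of "s * t * norm k"]] eventually_sequentiallyI[of 1])
        auto
    moreover have "(\<lambda>n. ?E s n (?E t n f)) \<longlonglongrightarrow> P s (P t f)"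
    proof -
      have "norm (?E s n (?E t n f - P t f)) \<le> norm (?E t n f - P t f)" for n
        using st by (intro J_power_norm) auto
      moreover have "(\<lambda>n. norm (?E t n f - P t f)) \<longlonglongrightarrow> 0"
        using P_tendsto[OF st(2), of f] by (simp add: LIM_zero tendsto_norm_zero)
      ultimately have "(\<lambda>n. ?E s n (?E t n f - P t f)) \<longlonglongrightarrow> 0"
        by (rule Lim_null_comparison[OF always_eventually, rule_format])
      from tendsto_add[OF this P_tendsto[OF st(1), of "P t f"]] show ?thesis
        using st by (simp flip: J_power_add)
    qed
    ultimately have "(\<lambda>n. ?E (s + t) n f) \<longlonglongrightarrow> P s (P t f)"
      using tendsto_diff by fastforce
    then show ?thesis
      using P_tendsto[of "s + t" f] st LIMSEQ_unique by (auto simp: S_def)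
  qed
  moreover have "closed S"
  proof -
    have "bounded_linear (\<lambda>f. P s (P t f))"
      using st by (intro bounded_linear_compose[OF bounded_linear_P bounded_linear_P])
    then have "closed {f. P (s + t) f = P s (P t f)}"
      using st by (intro closed_Collect_eq[OF linear_continuous_on linear_continuous_on] bounded_linear_P) simp_all
    then show ?thesis by (simp add: S_def)
  qed
  ultimately have "closure domain2 \<subseteq> S" by (intro closure_minimal) auto
  then show ?thesis using dense_domain2 by (auto simp: S_def)
qed

lemma norm_P_diff_le:
  assumes "(f, h) \<in> A" "t \<ge> 0"
  shows "norm (P t f - f) \<le> t * norm h"
proof (rule LIMSEQ_le_const2)
  show "(\<lambda>n. norm ((J (t / real n) ^^ n) f - f)) \<longlonglongrightarrow> norm (P t f - f)"
    by (intro tendsto_intros P_tendsto assms)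
  have "norm ((J (t / real n) ^^ n) f - f) \<le> t * norm h" if "n > 0" for n
  proof -
    have t: "t / n \<ge> 0" using assms by simp
    have "norm ((J (t / real n) ^^ i) f - f) \<le> i * (t / n * norm h)" for i
    proof (induction i)
      case (Suc i)
      have "norm ((J (t / real n) ^^ Suc i) f - f)
          \<le> norm (J (t / n) ((J (t / real n) ^^ i) f - f)) + norm (J (t / n) f - f)"
        using norm_triangle_ineq[of "J (t / n) ((J (t / real n) ^^ i) f - f)" "J (t / n) f - f"] t
        by (simp add: J_diff)
      also have "\<dots> \<le> i * (t / n * norm h) + t / n * norm h"
        using Suc J_norm[OF t] norm_J_diff_le[OF assms(1) t] by (meson add_mono order_trans)
      also have "\<dots> = Suc i * (t / n * norm h)" by (simp only: of_nat_Suc distrib_right mult_1 add.commute)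
      finally show ?case .
    qed simp
    from this[of n] show ?thesis using that by (simp add: field_simps)
  qed
  then show "\<exists>N. \<forall>n\<ge>N. norm ((J (t / real n) ^^ n) f - f) \<le> t * norm h"
    by (intro exI[of _ 1]) auto
qed

lemma P_strongly_continuous: "((\<lambda>t. P t f) \<longlongrightarrow> f) (at_right 0)"
proof (rule tendstoI)
  fix e :: real assume e: "e > 0"
  have "f \<in> closure (fst ` A)" using dense by simp
  then obtain g h where g: "(g, h) \<in> A" "dist g f < e / 3"
    unfolding closure_approachable using e
    by (metis (no_types, lifting) image_iff prod.collapse zero_less_divide_iff zero_less_numeral)
  define d where "d = e / (3 * (norm h + 1))"
  have d: "d > 0" using e by (simp add: d_def add_nonneg_pos)
  have "dist (P t f) f < e" if "0 < t" "t < d" for t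
  proof -
    have "dist (P t f) f \<le> norm (P t (f - g)) + norm (P t g - g) + norm (g - f)"
      using that P_diff[of t f g]
      by (smt (verit, del_insts) dist_norm norm_triangle_ineq add_diff_eq diff_add_cancel)
    also have "norm (P t (f - g)) \<le> norm (f - g)" using that by (intro P_norm) auto
    also have "norm (P t g - g) \<le> t * norm h" using that by (intro norm_P_diff_le g) auto
    also have "t * norm h \<le> d * (norm h + 1)" using that d by (intro mult_mono) auto
    also have "\<dots> = e / 3" by (simp add: d_def add_nonneg_eq_0_iff divide_simps)
    finally show ?thesis using g(2) by (simp add: dist_norm norm_minus_commute)
  qed
  then show "\<forall>\<^sub>F t in at_right 0. dist (P t f) f < e"
    using d by (auto simp: eventually_at_right_field)
qed

lemma norm_P_J_diff_le:
  assumes A: "(f, h) \<in> A" "(h, k) \<in> A" and t: "t \<ge> 0"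
  shows "norm (P t f - J t f) \<le> t\<^sup>2 * norm k"
proof (rule LIMSEQ_le_const2)
  show "(\<lambda>n. norm ((J (t / real n) ^^ n) f - J t f)) \<longlonglongrightarrow> norm (P t f - J t f)"
    by (intro tendsto_intros P_tendsto t)
  have "norm ((J (t / real n) ^^ n) f - J t f) \<le> t\<^sup>2 * norm k" if "n > 0" for n
    using J_power_near_J[OF A, of "t / n" n] t that by simp
  then show "\<exists>N. \<forall>n\<ge>N. norm ((J (t / real n) ^^ n) f - J t f) \<le> t\<^sup>2 * norm k"
    by (intro exI[of _ 1]) auto
qed

lemma norm_P_expansion_le:
  assumes A: "(f, h) \<in> A" "(h, k) \<in> A" and t: "t \<ge> 0"
  shows "norm (P t f - f - t *\<^sub>R h) \<le> 2 * t\<^sup>2 * norm k"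
proof -
  have eq: "P t f - f - t *\<^sub>R h = (P t f - J t f) + t *\<^sub>R (J t h - h)"
  proof -
    have "J t f = f + t *\<^sub>R J t h" using J_A(2)[OF A(1) t] by (simp add: algebra_simps)
    then show ?thesis by (simp add: scaleR_diff_right)
  qed
  then have "norm (P t f - f - t *\<^sub>R h) \<le> norm (P t f - J t f) + t * norm (J t h - h)"
    using norm_triangle_ineq[of "P t f - J t f" "t *\<^sub>R (J t h - h)"] t unfolding eq by simp
  also have "\<dots> \<le> t\<^sup>2 * norm k + t * (t * norm k)"
    using norm_P_J_diff_le[OF A t] norm_J_diff_le[OF A(2) t] t by (intro add_mono mult_left_mono)
  finally show ?thesis by (simp add: power2_eq_square)
qed

text \<open>The quadratic estimate is available for \<open>J c f\<close> only. The remainder \<open>f - J c f\<close> is controlled by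
  the first order bound, since \<open>A (f - J c f) = h - J c h\<close> is small for small \<open>c\<close>.\<close>

lemma A_subset_generator: "A \<subseteq> infinitesimal_generator P"
proof
  fix p assume "p \<in> A"
  then obtain f h where p: "p = (f, h)" and A: "(f, h) \<in> A" by (cases p) auto
  have "((\<lambda>t. (P t f - f) /\<^sub>R t) \<longlongrightarrow> h) (at_right 0)"
  proof (rule tendstoI)
    fix e :: real assume e: "e > 0"
    have "eventually (\<lambda>c. dist (J c h) h < e / 4) (at_right 0)"
      using e by (intro tendstoD[OF J_tendsto]) auto
    then obtain d where d: "d > 0" "\<And>c. 0 < c \<Longrightarrow> c < d \<Longrightarrow> dist (J c h) h < e / 4"
      by (auto simp: eventually_at_right_field)
    define c where "c = d / 2"
    have c: "c > 0" "dist (J c h) h < e / 4" using d by (auto simp: c_def)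
    obtain k where k: "(J c f, J c h) \<in> A" "(J c h, k) \<in> A"
      using J_domain2[OF A c(1)] .
    define r where "r = e / (4 * (norm k + 1))"
    have nk: "norm k + 1 > 0" by (simp add: add_nonneg_pos)
    have r: "r > 0" using e nk by (simp add: r_def)
    have "dist ((P t f - f) /\<^sub>R t) h < e" if t: "0 < t" "t < r" for t
    proof -
      have "norm (P t f - f - t *\<^sub>R h)
          = norm ((P t (f - J c f) - (f - J c f)) + (P t (J c f) - J c f - t *\<^sub>R J c h) + t *\<^sub>R (J c h - h))"
        using t by (simp add: P_diff algebra_simps)
      also have "\<dots> \<le> norm (P t (f - J c f) - (f - J c f))
          + norm (P t (J c f) - J c f - t *\<^sub>R J c h) + norm (t *\<^sub>R (J c h - h))"
        by (intro order_trans[OF norm_triangle_ineq] add_right_mono norm_triangle_ineq)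
      also have "\<dots> \<le> t * norm (h - J c h) + 2 * t\<^sup>2 * norm k + t * norm (J c h - h)"
        using norm_P_diff_le[OF A_diff[OF A k(1)], of t] norm_P_expansion_le[OF k, of t] t
        by (intro add_mono) auto
      also have "\<dots> = t * (2 * dist (J c h) h + 2 * t * norm k)"
        by (simp add: dist_norm norm_minus_commute power2_eq_square algebra_simps)
      finally have "norm (P t f - f - t *\<^sub>R h) \<le> t * (2 * dist (J c h) h + 2 * t * norm k)" .
      moreover have "(P t f - f) /\<^sub>R t - h = (P t f - f - t *\<^sub>R h) /\<^sub>R t"
        using t by (simp add: scaleR_diff_right)
      then have "dist ((P t f - f) /\<^sub>R t) h = norm (P t f - f - t *\<^sub>R h) / t"
        using t by (simp add: dist_norm divide_inverse_commute)
      ultimately have "dist ((P t f - f) /\<^sub>R t) h \<le> 2 * dist (J c h) h + 2 * t * norm k"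
        using t by (simp add: divide_le_eq mult.commute)
      also have "2 * t * norm k \<le> 2 * r * (norm k + 1)"
        using t r by (intro mult_mono) auto
      also have "\<dots> = e / 2" using nk by (simp add: r_def del: distrib_left_numeral)
      finally show ?thesis using c(2) by simp
    qed
    then show "eventually (\<lambda>t. dist ((P t f - f) /\<^sub>R t) h < e) (at_right 0)"
      using r by (auto simp: eventually_at_right_field)
  qed
  then show "p \<in> infinitesimal_generator P" by (simp add: p infinitesimal_generator_def)
qed

text \<open>A generator of contractions cannot extend \<open>A\<close> properly: \<open>1 - A\<close> is already onto, and if the
  generator maps \<open>d\<close> to itself, then \<open>norm (P t d)\<close> would grow like \<open>(1 + t) * norm d\<close>, so \<open>d = 0\<close>.\<close>

theorem generator_P: "infinitesimal_generator P = A"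
proof
  show "infinitesimal_generator P \<subseteq> A"
  proof
    fix p assume "p \<in> infinitesimal_generator P"
    then obtain f g where p: "p = (f, g)" and g: "((\<lambda>t. (P t f - f) /\<^sub>R t) \<longlongrightarrow> g) (at_right 0)"
      by (auto simp: infinitesimal_generator_def)
    obtain f' h' where A: "(f', h') \<in> A" "f' - h' = f - g"
      using range[of 1 "f - g"] by auto
    then have h': "((\<lambda>t. (P t f' - f') /\<^sub>R t) \<longlongrightarrow> h') (at_right 0)"
      using A_subset_generator by (auto simp: infinitesimal_generator_def)
    define d where "d = f - f'"
    have gd: "g - h' = d" using A(2) by (simp add: d_def algebra_simps)
    have "((\<lambda>t. (P t f - f) /\<^sub>R t - (P t f' - f') /\<^sub>R t) \<longlongrightarrow> d) (at_right 0)"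
      using tendsto_diff[OF g h'] by (simp add: gd)
    moreover have "eventually (\<lambda>t. (P t f - f) /\<^sub>R t - (P t f' - f') /\<^sub>R t = (P t d - d) /\<^sub>R t) (at_right 0)"
      using eventually_at_right_less[of "0::real"]
      by eventually_elim (simp add: d_def P_diff algebra_simps)
    ultimately have "((\<lambda>t. (P t d - d) /\<^sub>R t) \<longlongrightarrow> d) (at_right 0)"
      using tendsto_cong by fast
    then have "((\<lambda>t. norm ((P t d - d) /\<^sub>R t - d)) \<longlongrightarrow> 0) (at_right 0)"
      by (simp add: LIM_zero tendsto_norm_zero)
    moreover have "eventually (\<lambda>t. norm d \<le> norm ((P t d - d) /\<^sub>R t - d)) (at_right 0)"
      using eventually_at_right_less[of "0::real"]
    proof eventually_elim
      fix t :: real assume t: "0 < t"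
      have "t *\<^sub>R ((P t d - d) /\<^sub>R t - d) = P t d - (1 + t) *\<^sub>R d"
        using t by (simp add: algebra_simps)
      then have "t * norm ((P t d - d) /\<^sub>R t - d) = norm (P t d - (1 + t) *\<^sub>R d)"
        using t by (metis abs_of_pos norm_scaleR)
      also have "\<dots> \<ge> (1 + t) * norm d - norm (P t d)"
        using norm_triangle_ineq2[of "(1 + t) *\<^sub>R d" "P t d"] t by (simp add: norm_minus_commute)
      finally have "t * norm ((P t d - d) /\<^sub>R t - d) \<ge> (1 + t) * norm d - norm (P t d)" .
      with P_norm[of t d] t have "t * norm d \<le> t * norm ((P t d - d) /\<^sub>R t - d)"
        by (simp only: distrib_right) linarith
      with t show "norm d \<le> norm ((P t d - d) /\<^sub>R t - d)" by simp
    qed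
    ultimately have "norm d \<le> 0"
      by (intro tendsto_lowerbound[where F = "at_right (0::real)"]) auto
    then have "f = f'" "g = h'" using gd by (auto simp: d_def)
    with A p show "p \<in> A" by simp
  qed
qed (rule A_subset_generator)

text \<open>Any semigroup \<open>T\<close> with generator \<open>A\<close> commutes with the resolvents, and \<open>T u f - J u f\<close> is
  \<open>o (u)\<close> on the domain of \<open>A\<close>; telescoping \<open>(T (t / n))\<^sup>n - (J (t / n))\<^sup>n\<close> then identifies
  \<open>T t\<close> with the limit of the Euler scheme.\<close>

theorem C0_semigroup_unique:
  assumes T: "C0_semigroup T" and gen: "infinitesimal_generator T = A" and t: "t \<ge> 0"
  shows "T t f = P t f"
proof (cases "t = 0")
  case True
  then show ?thesis using T by (simp add: C0_semigroup_def P_0)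
next
  case False
  with t have t: "t > 0" by simp
  have lin: "bounded_linear (T s)" if "s \<ge> 0" for s using T that by (simp add: C0_semigroup_def)
  have diff: "T s (x - y) = T s x - T s y" if "s \<ge> 0" for s x y
    using linear_diff[OF bounded_linear.linear[OF lin[OF that]]] .
  have scale: "T s (r *\<^sub>R x) = r *\<^sub>R T s x" if "s \<ge> 0" for s r x
    using linear_scale[OF bounded_linear.linear[OF lin[OF that]]] .
  have comm: "T s (T u x) = T u (T s x)" if "s \<ge> 0" "u \<ge> 0" for s u x
  proof -
    have "T s (T u x) = T (s + u) x" "T u (T s x) = T (u + s) x"
      using T that by (auto simp: C0_semigroup_def)
    then show ?thesis by (simp add: add.commute)
  qed
  have quot: "((\<lambda>u. (T u f - f) /\<^sub>R u) \<longlongrightarrow> h) (at_right 0)" if "(f, h) \<in> A" for f h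
    using that gen by (auto simp: infinitesimal_generator_def)
  have TA: "(T s f, T s h) \<in> A" if A: "(f, h) \<in> A" and s: "s \<ge> 0" for f h s
  proof -
    have "((\<lambda>u. T s ((T u f - f) /\<^sub>R u)) \<longlongrightarrow> T s h) (at_right 0)"
      by (rule bounded_linear.tendsto[OF lin[OF s] quot[OF A]])
    moreover have "eventually (\<lambda>u. T s ((T u f - f) /\<^sub>R u) = (T u (T s f) - T s f) /\<^sub>R u) (at_right 0)"
      using eventually_at_right_less[of "0::real"]
      by eventually_elim (use s in \<open>simp add: scale diff comm\<close>)
    ultimately have "((\<lambda>u. (T u (T s f) - T s f) /\<^sub>R u) \<longlongrightarrow> T s h) (at_right 0)"
      using tendsto_cong by fast
    then show ?thesis using gen by (auto simp: infinitesimal_generator_def)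
  qed
  have TJ: "T s (J c g) = J c (T s g)" if s: "s \<ge> 0" and c: "c > 0" for s c g
  proof -
    obtain h where h: "(J c g, h) \<in> A" "J c g - c *\<^sub>R h = g" using J_cases[OF c] by metis
    have "T s g = T s (J c g) - c *\<^sub>R T s h"
      using h(2) s by (metis diff scale)
    then show ?thesis using J_eq[OF TA[OF h(1) s], of c] c by simp
  qed
  obtain M where M: "\<And>s x. 0 \<le> s \<Longrightarrow> s \<le> t \<Longrightarrow> norm (T s x) \<le> M * norm x"
    using C0_semigroup_locally_bounded[OF T] by metis
  have M0: "norm (T s x) \<le> max M 0 * norm x" if "0 \<le> s" "s \<le> t" for s x
    using M[OF that, of x] by (meson dual_order.trans max.cobounded1 mult_right_mono norm_ge_zero)
  define S where "S = {f. T t f = P t f}"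
  have "f \<in> S" if f: "f \<in> fst ` A" for f
  proof -
    obtain h where A: "(f, h) \<in> A" using f by force
    have bound: "norm (T t f - (J (t / n) ^^ n) f) \<le> max M 0 * t * norm ((T (t / n) f - f) /\<^sub>R (t / n) - J (t / n) h)"
      if n: "n > 0" for n :: nat
    proof -
      let ?u = "t / n"
      have u: "?u > 0" using t n by simp
      have "norm ((T ?u ^^ n) f - (J ?u ^^ n) f) \<le> max M 0 * of_nat n * norm (T ?u f - J ?u f)"
      proof (rule norm_funpow_diff_le)
        fix k :: nat and x y assume k: "k \<le> n"
        have "k * ?u \<le> t" using k n t by (simp add: field_simps)
        then have "norm (T (k * ?u) (x - y)) \<le> max M 0 * norm (x - y)" using t by (intro M0) auto
        then show "norm ((T ?u ^^ k) x - (T ?u ^^ k) y) \<le> max M 0 * norm (x - y)"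
          using C0_semigroup_power[OF T, of ?u k] u diff[of "k * ?u" x y] t by simp
      next
        show "norm (J ?u x - J ?u y) \<le> norm (x - y)" for x y
          using u by (simp add: J_norm flip: J_diff)
        show "T ?u (J ?u x) = J ?u (T ?u x)" for x using u by (intro TJ) auto
      qed simp
      also have "(T ?u ^^ n) f = T t f"
        using C0_semigroup_power[OF T, of ?u n f] u n by simp
      also have "T ?u f - J ?u f = ?u *\<^sub>R ((T ?u f - f) /\<^sub>R ?u - J ?u h)"
      proof -
        have "?u *\<^sub>R ((T ?u f - f) /\<^sub>R ?u - J ?u h) = (T ?u f - f) - ?u *\<^sub>R J ?u h"
          using t n by (simp add: scaleR_diff_right)
        also have "\<dots> = (T ?u f - f) - (J ?u f - f)" using J_A(2)[OF A, of ?u] u by simp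
        finally show ?thesis by simp
      qed
      also have "norm (?u *\<^sub>R ((T ?u f - f) /\<^sub>R ?u - J ?u h)) = ?u * norm ((T ?u f - f) /\<^sub>R ?u - J ?u h)"
        using u by (simp only: norm_scaleR abs_of_pos)
      finally show ?thesis using n by (simp add: mult.assoc)
    qed
    have "((\<lambda>u. norm ((T u f - f) /\<^sub>R u - J u h)) \<longlongrightarrow> norm (h - h)) (at_right 0)"
      by (intro tendsto_intros quot A J_tendsto)
    moreover have "filterlim (\<lambda>n. t / real n) (at_right 0) sequentially"
      unfolding filterlim_at
      using t by (auto intro!: lim_const_over_n eventually_sequentiallyI[of 1])
    ultimately have "(\<lambda>n. norm ((T (t / real n) f - f) /\<^sub>R (t / real n) - J (t / real n) h)) \<longlonglongrightarrow> norm (h - h)"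
      by (rule filterlim_compose)
    then have "(\<lambda>n. max M 0 * t * norm ((T (t / real n) f - f) /\<^sub>R (t / real n) - J (t / real n) h)) \<longlonglongrightarrow> max M 0 * t * norm (h - h)"
      by (intro tendsto_mult tendsto_const)
    then have "(\<lambda>n. max M 0 * t * norm ((T (t / real n) f - f) /\<^sub>R (t / real n) - J (t / real n) h)) \<longlonglongrightarrow> 0"
      by simp
    then have "(\<lambda>n. T t f - (J (t / real n) ^^ n) f) \<longlonglongrightarrow> 0"
      by (rule Lim_null_comparison[OF eventually_sequentiallyI[of 1], rotated]) (use bound in auto)
    then have "(\<lambda>n. (J (t / real n) ^^ n) f) \<longlonglongrightarrow> T t f"
      using tendsto_diff[OF tendsto_const[of "T t f"]] by fastforce
    then show ?thesis using P_tendsto[of t f] t LIMSEQ_unique by (auto simp: S_def)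
  qed
  moreover have "closed S"
    unfolding S_def using t
    by (intro closed_Collect_eq[OF linear_continuous_on linear_continuous_on] bounded_linear_P lin) simp_all
  ultimately have "closure (fst ` A) \<subseteq> S" by (intro closure_minimal) auto
  then show ?thesis using dense by (auto simp: S_def)
qed

end

section \<open>The Friedrichs extension of a nonnegative symmetric operator\<close>

text \<open>A symmetric operator \<open>L\<close> on a dense subspace \<open>D\<close> of a Hilbert space; the values of \<open>L\<close> outside
  \<open>D\<close> are arbitrary.\<close>

locale nonneg_symmetric_operator =
  fixes D :: "'a::{real_inner, banach} set" and L :: "'a \<Rightarrow> 'a"
  assumes subspace_D: "subspace D"
    and dense_D: "closure D = UNIV"
    and L_add: "u \<in> D \<Longrightarrow> v \<in> D \<Longrightarrow> L (u + v) = L u + L v"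
    and L_scale: "u \<in> D \<Longrightarrow> L (r *\<^sub>R u) = r *\<^sub>R L u"
    and L_sym: "u \<in> D \<Longrightarrow> v \<in> D \<Longrightarrow> L u \<bullet> v = u \<bullet> L v"
    and L_nonneg: "u \<in> D \<Longrightarrow> 0 \<le> L u \<bullet> u"
begin

abbreviation E :: "'a \<Rightarrow> 'a \<Rightarrow> real" where
  "E u v \<equiv> L u \<bullet> v"

definition approximates :: "(nat \<Rightarrow> 'a) \<Rightarrow> 'a \<Rightarrow> bool" where
  "approximates \<phi> f \<longleftrightarrow> (\<forall>n. \<phi> n \<in> D) \<and> \<phi> \<longlonglongrightarrow> f \<and>
     (\<forall>e>0. \<exists>N. \<forall>i\<ge>N. \<forall>j\<ge>N. E (\<phi> i - \<phi> j) (\<phi> i - \<phi> j) < e)"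

definition form_dom :: "'a set" where
  "form_dom = {f. \<exists>\<phi>. approximates \<phi> f}"

definition form :: "'a \<Rightarrow> 'a \<Rightarrow> real" where
  "form f g = (THE q. \<forall>\<phi> \<psi>. approximates \<phi> f \<longrightarrow> approximates \<psi> g \<longrightarrow>
     (\<lambda>n. E (\<phi> n) (\<psi> n)) \<longlonglongrightarrow> q)"

definition friedrichs :: "('a \<times> 'a) set" where
  "friedrichs = {(f, h). f \<in> form_dom \<and> (\<forall>g\<in>form_dom. form f g = h \<bullet> g)}"

lemma D_add: "u \<in> D \<Longrightarrow> v \<in> D \<Longrightarrow> u + v \<in> D"
  using subspace_add[OF subspace_D] .

lemma D_diff: "u \<in> D \<Longrightarrow> v \<in> D \<Longrightarrow> u - v \<in> D"
  using subspace_diff[OF subspace_D] .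

lemma D_scale: "u \<in> D \<Longrightarrow> r *\<^sub>R u \<in> D"
  using subspace_scale[OF subspace_D] .

lemma L_diff: "u \<in> D \<Longrightarrow> v \<in> D \<Longrightarrow> L (u - v) = L u - L v"
  using L_add[of "u - v" v] D_diff by simp

lemma E_sym: "u \<in> D \<Longrightarrow> v \<in> D \<Longrightarrow> E u v = E v u"
  by (metis L_sym inner_commute)

lemma E_expand:
  assumes "u \<in> D" "v \<in> D"
  shows "E (u + r *\<^sub>R v) (u + r *\<^sub>R v) = E u u + 2 * r * E u v + r\<^sup>2 * E v v"
proof -
  have "E (u + r *\<^sub>R v) (u + r *\<^sub>R v) = E u u + r * E u v + r * E v u + r\<^sup>2 * E v v"
    using assms D_scale
    by (simp add: L_add L_scale inner_add_left inner_add_right power2_eq_square algebra_simps)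
  then show ?thesis using E_sym[OF assms] by simp
qed

lemma E_parallelogram:
  assumes "u \<in> D" "v \<in> D"
  shows "E (u + v) (u + v) + E (u - v) (u - v) = 2 * E u u + 2 * E v v"
  using E_expand[OF assms, of 1] E_expand[OF assms, of "-1"] by simp

lemma E_Cauchy_Schwarz:
  assumes "u \<in> D" "v \<in> D"
  shows "(E u v)\<^sup>2 \<le> E u u * E v v"
proof -
  have *: "0 \<le> E u u + 2 * r * E u v + r\<^sup>2 * E v v" for r
    using L_nonneg[of "u + r *\<^sub>R v"] assms D_scale D_add E_expand[OF assms] by metis
  show ?thesis
  proof (cases "E v v = 0")
    case True
    have "E u v = 0"
    proof (rule ccontr)
      assume "E u v \<noteq> 0"
      then show False using *[of "- (E u u + 1) / (2 * E u v)"] True by (simp add: field_simps)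
    qed
    then show ?thesis using True by simp
  next
    case False
    with L_nonneg[OF assms(2)] have "E v v > 0" by simp
    then show ?thesis using *[of "- (E u v) / E v v"]
      by (simp add: field_simps power2_eq_square)
  qed
qed

lemma approximates_add_scale:
  assumes "approximates \<phi> f" "approximates \<psi> g"
  shows "approximates (\<lambda>n. \<phi> n + r *\<^sub>R \<psi> n) (f + r *\<^sub>R g)"
  unfolding approximates_def
proof (intro conjI allI impI)
  have \<phi>: "\<And>n. \<phi> n \<in> D" "\<phi> \<longlonglongrightarrow> f" and \<psi>: "\<And>n. \<psi> n \<in> D" "\<psi> \<longlonglongrightarrow> g"
    using assms by (auto simp: approximates_def)
  show "\<phi> n + r *\<^sub>R \<psi> n \<in> D" for n by (intro D_add D_scale \<phi> \<psi>)
  show "(\<lambda>n. \<phi> n + r *\<^sub>R \<psi> n) \<longlonglongrightarrow> f + r *\<^sub>R g" by (intro tendsto_intros \<phi> \<psi>)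
  fix e :: real assume e: "e > 0"
  define d where "d = e / (4 * (1 + r\<^sup>2))"
  have r: "1 + r\<^sup>2 > 0" by (simp add: add_pos_nonneg)
  then have d: "d > 0" using e by (simp add: d_def)
  obtain N where N: "\<And>i j. i \<ge> N \<Longrightarrow> j \<ge> N \<Longrightarrow> E (\<phi> i - \<phi> j) (\<phi> i - \<phi> j) < d"
    using assms(1) d by (force simp: approximates_def)
  obtain N' where N': "\<And>i j. i \<ge> N' \<Longrightarrow> j \<ge> N' \<Longrightarrow> E (\<psi> i - \<psi> j) (\<psi> i - \<psi> j) < d"
    using assms(2) d by (force simp: approximates_def)
  have "E (\<phi> i + r *\<^sub>R \<psi> i - (\<phi> j + r *\<^sub>R \<psi> j)) (\<phi> i + r *\<^sub>R \<psi> i - (\<phi> j + r *\<^sub>R \<psi> j)) < e"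
    if ij: "i \<ge> max N N'" "j \<ge> max N N'" for i j
  proof -
    let ?u = "\<phi> i - \<phi> j" and ?v = "\<psi> i - \<psi> j"
    have D: "?u \<in> D" "r *\<^sub>R ?v \<in> D" "?v \<in> D" by (intro D_diff D_scale \<phi> \<psi>)+
    have eq: "\<phi> i + r *\<^sub>R \<psi> i - (\<phi> j + r *\<^sub>R \<psi> j) = ?u + r *\<^sub>R ?v" by (simp add: algebra_simps)
    have "E (?u + r *\<^sub>R ?v) (?u + r *\<^sub>R ?v) \<le> 2 * E ?u ?u + 2 * E (r *\<^sub>R ?v) (r *\<^sub>R ?v)"
      using E_parallelogram[OF D(1,2)] L_nonneg[OF D_diff[OF D(1,2)]] by simp
    also have "E (r *\<^sub>R ?v) (r *\<^sub>R ?v) = r\<^sup>2 * E ?v ?v" using D by (simp add: L_scale power2_eq_square)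
    also have "2 * E ?u ?u + 2 * (r\<^sup>2 * E ?v ?v) \<le> 2 * d + 2 * (r\<^sup>2 * d)"
      using N[of i j] N'[of i j] ij by (intro add_mono mult_left_mono) auto
    also have "\<dots> = (1 + r\<^sup>2) * (2 * d)" by (simp add: algebra_simps)
    also have "\<dots> = e / 2" using r by (simp add: d_def del: distrib_left_numeral)
    also have "\<dots> < e" using e by simp
    finally show ?thesis unfolding eq .
  qed
  then show "\<exists>N. \<forall>i\<ge>N. \<forall>j\<ge>N.
      E (\<phi> i + r *\<^sub>R \<psi> i - (\<phi> j + r *\<^sub>R \<psi> j)) (\<phi> i + r *\<^sub>R \<psi> i - (\<phi> j + r *\<^sub>R \<psi> j)) < e"
    by blast
qed

lemma approximates_const: "u \<in> D \<Longrightarrow> approximates (\<lambda>_. u) u"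
  using L_diff[of u u] by (simp add: approximates_def)

lemma approximates_bounded:
  assumes "approximates \<phi> f"
  obtains B where "B > 0" "\<And>n. E (\<phi> n) (\<phi> n) \<le> B"
proof -
  have \<phi>: "\<And>n. \<phi> n \<in> D" using assms by (auto simp: approximates_def)
  obtain N where N: "\<And>i j. i \<ge> N \<Longrightarrow> j \<ge> N \<Longrightarrow> E (\<phi> i - \<phi> j) (\<phi> i - \<phi> j) < 1"
    using assms by (force simp: approximates_def)
  define B where "B = (\<Sum>i\<le>N. E (\<phi> i) (\<phi> i)) * 2 + 2"
  have sum: "E (\<phi> i) (\<phi> i) \<le> (\<Sum>i\<le>N. E (\<phi> i) (\<phi> i))" if "i \<le> N" for i
    using that by (intro member_le_sum) (auto simp: L_nonneg \<phi>)
  have pos: "(\<Sum>i\<le>N. E (\<phi> i) (\<phi> i)) \<ge> 0" by (intro sum_nonneg L_nonneg \<phi>)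
  have "E (\<phi> n) (\<phi> n) \<le> B" for n
  proof (cases "n \<le> N")
    case True
    then show ?thesis using sum[OF True] pos by (simp add: B_def)
  next
    case False
    have D: "\<phi> N \<in> D" "\<phi> n - \<phi> N \<in> D" by (intro D_diff \<phi>)+
    have "E (\<phi> n) (\<phi> n) \<le> 2 * E (\<phi> N) (\<phi> N) + 2 * E (\<phi> n - \<phi> N) (\<phi> n - \<phi> N)"
      using E_parallelogram[OF D] L_nonneg[OF D_diff[OF D]] by simp
    also have "\<dots> \<le> B" using N[of n N] False sum[of N] by (simp add: B_def)
    finally show ?thesis .
  qed
  moreover have "B > 0" using pos by (simp add: B_def)
  ultimately show ?thesis using that by blast
qed

text \<open>Closability. For fixed \<open>n\<close> the mixed terms \<open>E (\<phi> n) (\<phi> k) = L (\<phi> n) \<bullet> \<phi> k\<close> tend to \<open>0\<close>,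
  because the form comes from an operator.\<close>

lemma form_closable:
  assumes "approximates \<phi> 0"
  shows "(\<lambda>n. E (\<phi> n) (\<phi> n)) \<longlonglongrightarrow> 0"
proof (rule LIMSEQ_I)
  fix e :: real assume e: "e > 0"
  have \<phi>: "\<And>n. \<phi> n \<in> D" "\<phi> \<longlonglongrightarrow> 0" using assms by (auto simp: approximates_def)
  obtain B where B: "B > 0" "\<And>n. E (\<phi> n) (\<phi> n) \<le> B" using approximates_bounded[OF assms] by blast
  \<comment> \<open>Cauchy-Schwarz turns a form distance below \<open>d\<close> into \<open>E (\<phi> n) (\<phi> n - \<phi> k) \<le> e / 2\<close>\<close>
  define d where "d = (e / 2)\<^sup>2 / B"
  have d: "d > 0" using e B by (simp add: d_def)
  obtain N where N: "\<And>i j. i \<ge> N \<Longrightarrow> j \<ge> N \<Longrightarrow> E (\<phi> i - \<phi> j) (\<phi> i - \<phi> j) < d"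
    using assms d by (force simp: approximates_def)
  have "E (\<phi> n) (\<phi> n) \<le> e / 2" if n: "n \<ge> N" for n
  proof (rule LIMSEQ_le_const2)
    have "(\<lambda>k. E (\<phi> n) (\<phi> n) - E (\<phi> n) (\<phi> k)) \<longlonglongrightarrow> E (\<phi> n) (\<phi> n) - E (\<phi> n) 0"
      by (intro tendsto_intros \<phi>)
    then show "(\<lambda>k. E (\<phi> n) (\<phi> n) - E (\<phi> n) (\<phi> k)) \<longlonglongrightarrow> E (\<phi> n) (\<phi> n)" by simp
    have "E (\<phi> n) (\<phi> n) - E (\<phi> n) (\<phi> k) \<le> e / 2" if k: "k \<ge> N" for k
    proof -
      have "(E (\<phi> n) (\<phi> n - \<phi> k))\<^sup>2 \<le> E (\<phi> n) (\<phi> n) * E (\<phi> n - \<phi> k) (\<phi> n - \<phi> k)"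
        by (intro E_Cauchy_Schwarz D_diff \<phi>)
      also have "\<dots> \<le> B * d"
        using B N[OF n k] by (intro mult_mono) (auto intro: L_nonneg D_diff \<phi>)
      also have "\<dots> = (e / 2)\<^sup>2" using B by (simp add: d_def)
      finally have "E (\<phi> n) (\<phi> n - \<phi> k) \<le> e / 2" using e by (simp add: power2_le_iff_abs_le abs_le_iff)
      then show ?thesis by (simp add: inner_diff_right)
    qed
    then show "\<exists>N. \<forall>k\<ge>N. E (\<phi> n) (\<phi> n) - E (\<phi> n) (\<phi> k) \<le> e / 2" by blast
  qed
  then have "norm (E (\<phi> n) (\<phi> n) - 0) < e" if "n \<ge> N" for n
    using that L_nonneg[OF \<phi>(1), of n] e by fastforce
  then show "\<exists>N. \<forall>n\<ge>N. norm (E (\<phi> n) (\<phi> n) - 0) < e" by blast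
qed

lemma tendsto_E_0:
  assumes u: "\<And>n. u n \<in> D" and v: "\<And>n. v n \<in> D"
    and u0: "(\<lambda>n. E (u n) (u n)) \<longlonglongrightarrow> 0" and B: "\<And>n. E (v n) (v n) \<le> B"
  shows "(\<lambda>n. E (u n) (v n)) \<longlonglongrightarrow> 0"
proof -
  have B0: "B \<ge> 0" using B[of 0] L_nonneg[OF v, of 0] by simp
  have "(\<lambda>n. sqrt (E (u n) (u n) * B)) \<longlonglongrightarrow> sqrt (0 * B)"
    by (intro tendsto_intros u0)
  then have "(\<lambda>n. sqrt (E (u n) (u n) * B)) \<longlonglongrightarrow> 0" by simp
  moreover have "norm (E (u n) (v n)) \<le> sqrt (E (u n) (u n) * B)" for n
  proof -
    have "(E (u n) (v n))\<^sup>2 \<le> E (u n) (u n) * E (v n) (v n)" by (intro E_Cauchy_Schwarz u v)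
    also have "\<dots> \<le> E (u n) (u n) * B" by (intro mult_left_mono B L_nonneg u)
    finally show ?thesis by (simp add: real_le_rsqrt)
  qed
  then have "eventually (\<lambda>n. norm (E (u n) (v n)) \<le> sqrt (E (u n) (u n) * B)) sequentially"
    by simp
  ultimately show ?thesis by (rule Lim_null_comparison[rotated])
qed

lemma E_convergent:
  assumes "approximates \<phi> f" "approximates \<psi> g"
  shows "convergent (\<lambda>n. E (\<phi> n) (\<psi> n))"
proof (rule Cauchy_convergent, rule CauchyI)
  fix e :: real assume e: "e > 0"
  have \<phi>: "\<And>n. \<phi> n \<in> D" and \<psi>: "\<And>n. \<psi> n \<in> D"
    using assms by (auto simp: approximates_def)
  obtain B where B: "B > 0" "\<And>n. E (\<phi> n) (\<phi> n) \<le> B" using approximates_bounded[OF assms(1)] by blast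
  obtain C where C: "C > 0" "\<And>n. E (\<psi> n) (\<psi> n) \<le> C" using approximates_bounded[OF assms(2)] by blast
  define d where "d = (e / 2)\<^sup>2 / (B + C)"
  have d: "d > 0" using e B C by (simp add: d_def)
  obtain N where N: "\<And>i j. i \<ge> N \<Longrightarrow> j \<ge> N \<Longrightarrow> E (\<phi> i - \<phi> j) (\<phi> i - \<phi> j) < d"
    using assms(1) d by (force simp: approximates_def)
  obtain N' where N': "\<And>i j. i \<ge> N' \<Longrightarrow> j \<ge> N' \<Longrightarrow> E (\<psi> i - \<psi> j) (\<psi> i - \<psi> j) < d"
    using assms(2) d by (force simp: approximates_def)
  have CS: "\<bar>E u v\<bar> < e / 2" if "u \<in> D" "v \<in> D" "E u u * E v v < (B + C) * d" for u v
  proof -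
    have "(E u v)\<^sup>2 < (e / 2)\<^sup>2"
      using E_Cauchy_Schwarz[OF that(1,2)] that(3) B C by (simp add: d_def)
    then show ?thesis using e power2_less_imp_less[of "\<bar>E u v\<bar>" "e / 2"] by simp
  qed
  have "norm (E (\<phi> i) (\<psi> i) - E (\<phi> j) (\<psi> j)) < e" if ij: "i \<ge> max N N'" "j \<ge> max N N'" for i j
  proof -
    have 1: "\<bar>E (\<phi> i - \<phi> j) (\<psi> i)\<bar> < e / 2"
    proof (rule CS)
      have "E (\<phi> i - \<phi> j) (\<phi> i - \<phi> j) * E (\<psi> i) (\<psi> i) \<le> d * C"
        using N[of i j] C ij d by (intro mult_mono) (auto intro: L_nonneg \<psi>)
      also have "\<dots> < (B + C) * d" using B d by (simp add: distrib_right mult.commute)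
      finally show "E (\<phi> i - \<phi> j) (\<phi> i - \<phi> j) * E (\<psi> i) (\<psi> i) < (B + C) * d" .
    qed (intro D_diff \<phi> \<psi>)+
    have 2: "\<bar>E (\<phi> j) (\<psi> i - \<psi> j)\<bar> < e / 2"
    proof (rule CS)
      have "E (\<phi> j) (\<phi> j) * E (\<psi> i - \<psi> j) (\<psi> i - \<psi> j) \<le> B * d"
        using N'[of i j] B ij by (intro mult_mono) (auto intro: L_nonneg D_diff \<psi>)
      also have "\<dots> < (B + C) * d" using C d by (simp add: distrib_right)
      finally show "E (\<phi> j) (\<phi> j) * E (\<psi> i - \<psi> j) (\<psi> i - \<psi> j) < (B + C) * d" .
    qed (intro D_diff \<phi> \<psi>)+
    have "E (\<phi> i) (\<psi> i) - E (\<phi> j) (\<psi> j) = E (\<phi> i - \<phi> j) (\<psi> i) + E (\<phi> j) (\<psi> i - \<psi> j)"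
      by (simp add: L_diff \<phi> inner_diff_left inner_diff_right)
    then show ?thesis using 1 2 by simp
  qed
  then show "\<exists>M. \<forall>m\<ge>M. \<forall>n\<ge>M. norm (E (\<phi> m) (\<psi> m) - E (\<phi> n) (\<psi> n)) < e" by blast
qed

lemma E_limit_unique:
  assumes "approximates \<phi> f" "approximates \<psi> g" "approximates \<phi>' f" "approximates \<psi>' g"
  shows "(\<lambda>n. E (\<phi> n) (\<psi> n) - E (\<phi>' n) (\<psi>' n)) \<longlonglongrightarrow> 0"
proof -
  have D: "\<And>n. \<phi> n \<in> D" "\<And>n. \<psi> n \<in> D" "\<And>n. \<phi>' n \<in> D" "\<And>n. \<psi>' n \<in> D"
    using assms by (auto simp: approximates_def)
  have \<phi>0: "approximates (\<lambda>n. \<phi> n - \<phi>' n) 0"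
    using approximates_add_scale[OF assms(1,3), of "-1"] by simp
  have \<psi>0: "approximates (\<lambda>n. \<psi> n - \<psi>' n) 0"
    using approximates_add_scale[OF assms(2,4), of "-1"] by simp
  obtain B where B: "\<And>n. E (\<phi>' n) (\<phi>' n) \<le> B" using approximates_bounded[OF assms(3)] by metis
  obtain C where C: "\<And>n. E (\<psi> n) (\<psi> n) \<le> C" using approximates_bounded[OF assms(2)] by metis
  have 1: "(\<lambda>n. E (\<phi> n - \<phi>' n) (\<psi> n)) \<longlonglongrightarrow> 0"
    by (rule tendsto_E_0[OF _ _ form_closable[OF \<phi>0] C]) (intro D_diff D)+
  have 2: "(\<lambda>n. E (\<psi> n - \<psi>' n) (\<phi>' n)) \<longlonglongrightarrow> 0"
    by (rule tendsto_E_0[OF _ _ form_closable[OF \<psi>0] B]) (intro D_diff D)+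
  have "E (\<phi> n - \<phi>' n) (\<psi> n) + E (\<psi> n - \<psi>' n) (\<phi>' n) = E (\<phi> n) (\<psi> n) - E (\<phi>' n) (\<psi>' n)" for n
    using E_sym[OF D_diff[OF D(2,4)] D(3), of n n n]
    by (simp add: L_diff D inner_diff_left inner_diff_right)
  with tendsto_add[OF 1 2] show ?thesis by simp
qed

lemma form_tendsto:
  assumes "approximates \<phi> f" "approximates \<psi> g"
  shows "(\<lambda>n. E (\<phi> n) (\<psi> n)) \<longlonglongrightarrow> form f g"
proof -
  obtain q where q: "(\<lambda>n. E (\<phi> n) (\<psi> n)) \<longlonglongrightarrow> q"
    using E_convergent[OF assms] by (auto simp: convergent_def)
  have all: "(\<lambda>n. E (\<phi>' n) (\<psi>' n)) \<longlonglongrightarrow> q" if "approximates \<phi>' f" "approximates \<psi>' g" for \<phi>' \<psi>'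
    using tendsto_diff[OF q E_limit_unique[OF assms that]] by simp
  have "form f g = q"
    unfolding form_def
  proof (rule the_equality)
    show "\<forall>\<phi> \<psi>. approximates \<phi> f \<longrightarrow> approximates \<psi> g \<longrightarrow> (\<lambda>n. E (\<phi> n) (\<psi> n)) \<longlonglongrightarrow> q"
      using all by blast
    fix q' assume "\<forall>\<phi> \<psi>. approximates \<phi> f \<longrightarrow> approximates \<psi> g \<longrightarrow> (\<lambda>n. E (\<phi> n) (\<psi> n)) \<longlonglongrightarrow> q'"
    with assms have "(\<lambda>n. E (\<phi> n) (\<psi> n)) \<longlonglongrightarrow> q'" by blast
    then show "q' = q" using q by (rule LIMSEQ_unique)
  qed
  with q show ?thesis by simp
qed

lemma D_subset_form_dom: "D \<subseteq> form_dom"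
  using approximates_const by (auto simp: form_dom_def)

lemma form_eq_inner:
  assumes "f \<in> form_dom" "v \<in> D"
  shows "form f v = f \<bullet> L v"
proof -
  obtain \<phi> where \<phi>: "approximates \<phi> f" using assms by (auto simp: form_dom_def)
  have "(\<lambda>n. \<phi> n \<bullet> L v) \<longlonglongrightarrow> f \<bullet> L v"
    using \<phi> by (intro tendsto_intros) (auto simp: approximates_def)
  moreover have "\<phi> n \<bullet> L v = E (\<phi> n) v" for n
    using \<phi> assms by (simp add: L_sym approximates_def)
  ultimately show ?thesis
    using form_tendsto[OF \<phi> approximates_const[OF assms(2)]] by (simp add: LIMSEQ_unique)
qed

text \<open>It suffices to test against \<open>D\<close>, so the Friedrichs extension is the restriction of the
  adjoint of \<open>L\<close> to the form domain.\<close>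

lemma friedrichs_iff:
  "(f, h) \<in> friedrichs \<longleftrightarrow> f \<in> form_dom \<and> (\<forall>v\<in>D. f \<bullet> L v = h \<bullet> v)"
proof
  assume "(f, h) \<in> friedrichs"
  then show "f \<in> form_dom \<and> (\<forall>v\<in>D. f \<bullet> L v = h \<bullet> v)"
    using D_subset_form_dom form_eq_inner unfolding friedrichs_def by fastforce
next
  assume R: "f \<in> form_dom \<and> (\<forall>v\<in>D. f \<bullet> L v = h \<bullet> v)"
  then obtain \<phi> where \<phi>: "approximates \<phi> f" by (auto simp: form_dom_def)
  have "form f g = h \<bullet> g" if g: "g \<in> form_dom" for g
  proof -
    obtain \<psi> where \<psi>: "approximates \<psi> g" using g by (auto simp: form_dom_def)
    then have \<psi>D: "\<And>n. \<psi> n \<in> D" and \<psi>g: "\<psi> \<longlonglongrightarrow> g" by (auto simp: approximates_def)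
    \<comment> \<open>as \<open>E (\<phi> k - \<phi> n) (\<psi> n)\<close> is small for large \<open>k\<close>, \<open>n\<close>, both \<open>n \<mapsto> E (\<phi> n) (\<psi> n)\<close> and \<open>n \<mapsto> f \<bullet> L (\<psi> n)\<close> have the limit \<open>form f g\<close>\<close>
    have "(\<lambda>n. f \<bullet> L (\<psi> n)) \<longlonglongrightarrow> form f g"
    proof (rule LIMSEQ_I)
      fix e :: real assume e: "e > 0"
      obtain C where C: "C > 0" "\<And>n. E (\<psi> n) (\<psi> n) \<le> C" using approximates_bounded[OF \<psi>] by blast
      define d where "d = (e / 2)\<^sup>2 / C"
      have d: "d > 0" using e C by (simp add: d_def)
      obtain N where N: "\<And>i j. i \<ge> N \<Longrightarrow> j \<ge> N \<Longrightarrow> E (\<phi> i - \<phi> j) (\<phi> i - \<phi> j) < d"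
        using \<phi> d by (force simp: approximates_def)
      have \<phi>D: "\<And>n. \<phi> n \<in> D" and \<phi>f: "\<phi> \<longlonglongrightarrow> f" using \<phi> by (auto simp: approximates_def)
      have close: "\<bar>f \<bullet> L (\<psi> n) - E (\<phi> n) (\<psi> n)\<bar> \<le> e / 2" if n: "n \<ge> N" for n
      proof (rule LIMSEQ_le_const2)
        show "(\<lambda>k. \<bar>\<phi> k \<bullet> L (\<psi> n) - E (\<phi> n) (\<psi> n)\<bar>) \<longlonglongrightarrow> \<bar>f \<bullet> L (\<psi> n) - E (\<phi> n) (\<psi> n)\<bar>"
          by (intro tendsto_intros \<phi>f)
        have "\<bar>\<phi> k \<bullet> L (\<psi> n) - E (\<phi> n) (\<psi> n)\<bar> \<le> e / 2" if k: "k \<ge> N" for k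
        proof -
          have "(E (\<phi> k - \<phi> n) (\<psi> n))\<^sup>2 \<le> E (\<phi> k - \<phi> n) (\<phi> k - \<phi> n) * E (\<psi> n) (\<psi> n)"
            by (intro E_Cauchy_Schwarz D_diff \<phi>D \<psi>D)
          also have "\<dots> \<le> d * C"
            using N[OF k n] C d by (intro mult_mono) (auto intro: L_nonneg \<psi>D)
          also have "\<dots> = (e / 2)\<^sup>2" using C by (simp add: d_def)
          finally have "\<bar>E (\<phi> k - \<phi> n) (\<psi> n)\<bar> \<le> e / 2" using e by (simp add: power2_le_iff_abs_le)
          then show ?thesis by (simp add: L_diff L_sym \<phi>D \<psi>D inner_diff_left)
        qed
        then show "\<exists>N. \<forall>k\<ge>N. \<bar>\<phi> k \<bullet> L (\<psi> n) - E (\<phi> n) (\<psi> n)\<bar> \<le> e / 2" by blast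
      qed
      obtain N' where N': "\<And>n. n \<ge> N' \<Longrightarrow> norm (E (\<phi> n) (\<psi> n) - form f g) < e / 2"
        using LIMSEQ_D[OF form_tendsto[OF \<phi> \<psi>], of "e / 2"] e by auto
      have "norm (f \<bullet> L (\<psi> n) - form f g) < e" if "n \<ge> max N N'" for n
        using close[of n] N'[of n] that unfolding real_norm_def by linarith
      then show "\<exists>N. \<forall>n\<ge>N. norm (f \<bullet> L (\<psi> n) - form f g) < e" by blast
    qed
    moreover have "(\<lambda>n. f \<bullet> L (\<psi> n)) \<longlonglongrightarrow> h \<bullet> g"
      using R \<psi>D by (simp add: tendsto_inner[OF tendsto_const \<psi>g])
    ultimately show ?thesis by (rule LIMSEQ_unique)
  qed
  with R show "(f, h) \<in> friedrichs" by (auto simp: friedrichs_def)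
qed

lemma friedrichs_nonneg:
  assumes "(f, h) \<in> friedrichs"
  shows "h \<bullet> f \<ge> 0"
proof -
  obtain \<phi> where \<phi>: "approximates \<phi> f" using assms by (auto simp: friedrichs_def form_dom_def)
  have "form f f \<ge> 0"
    using \<phi> by (intro LIMSEQ_le_const[OF form_tendsto[OF \<phi> \<phi>]]) (auto simp: approximates_def intro: L_nonneg)
  then show ?thesis using assms by (auto simp: friedrichs_def)
qed

lemma friedrichs_extends:
  assumes "v \<in> D"
  shows "(v, L v) \<in> friedrichs"
  using assms D_subset_form_dom by (auto simp: friedrichs_iff L_sym)

lemma subspace_friedrichs: "subspace friedrichs"
proof -
  have add: "f + r *\<^sub>R g \<in> form_dom" if fg: "f \<in> form_dom" "g \<in> form_dom" for f g r
    using that approximates_add_scale unfolding form_dom_def by blast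
  have 0: "0 \<in> form_dom" using subspace_0[OF subspace_D] D_subset_form_dom by auto
  show ?thesis
    unfolding subspace_def
  proof (intro conjI ballI allI)
    show "0 \<in> friedrichs" using 0 by (simp add: zero_prod_def friedrichs_iff)
    fix p assume p: "p \<in> friedrichs"
    show "p + q \<in> friedrichs" if "q \<in> friedrichs" for q
      using p that add[of "fst p" "fst q" 1]
      by (cases p; cases q) (auto simp: friedrichs_iff inner_add_left)
    show "r *\<^sub>R p \<in> friedrichs" for r
      using p add[OF 0, of "fst p" r] by (cases p) (auto simp: friedrichs_iff)
  qed
qed

text \<open>The resolvent equation \<open>f + c h = g\<close> is the Euler-Lagrange equation of this functional.\<close>

definition dirichlet_functional :: "real \<Rightarrow> 'a \<Rightarrow> 'a \<Rightarrow> real" where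
  "dirichlet_functional c g v = c * E v v + (norm (v - g))\<^sup>2"

text \<open>The functional is quadratic and uniformly convex with respect to the form norm, so every
  minimizing sequence is Cauchy both in the Hilbert space and for \<open>E\<close>. The limit therefore lies in
  the domain of the closed form, although minimization only runs over \<open>D\<close>.\<close>

lemma minimizing_sequence_limit:
  assumes c: "c > 0" and \<phi>: "\<And>n. \<phi> n \<in> D"
    and min: "(\<lambda>n. dirichlet_functional c g (\<phi> n)) \<longlonglongrightarrow> I"
    and I: "\<And>v. v \<in> D \<Longrightarrow> I \<le> dirichlet_functional c g v"
  obtains f h where "\<phi> \<longlonglongrightarrow> f" "(f, h) \<in> friedrichs" "f + c *\<^sub>R h = g"
proof -
  let ?F = "dirichlet_functional c g"
  \<comment> \<open>the parallelogram law at the midpoint, where the functional is at least \<open>I\<close>\<close>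
  have par: "c * E (u - v) (u - v) + (norm (u - v))\<^sup>2 \<le> 2 * (?F u - I) + 2 * (?F v - I)"
    if uv: "u \<in> D" "v \<in> D" for u v
  proof -
    let ?w = "(1 / 2) *\<^sub>R (u + v)"
    have "I \<le> ?F ?w" using uv by (intro I D_scale D_add)
    also have "?F ?w = c * (E (u + v) (u + v) / 4) + (norm (u + v - 2 *\<^sub>R g))\<^sup>2 / 4"
    proof -
      have "?w - g = (1 / 2) *\<^sub>R (u + v - 2 *\<^sub>R g)" by (simp add: algebra_simps)
      then have "(norm (?w - g))\<^sup>2 = (norm (u + v - 2 *\<^sub>R g))\<^sup>2 / 4"
        by (simp only: norm_scaleR power_mult_distrib) (simp add: power2_eq_square)
      then show ?thesis using uv by (simp add: dirichlet_functional_def L_scale D_add)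
    qed
    finally have mid: "4 * I \<le> c * E (u + v) (u + v) + (norm (u + v - 2 *\<^sub>R g))\<^sup>2" by simp
    have "(norm (u + v - 2 *\<^sub>R g))\<^sup>2 + (norm (u - v))\<^sup>2 = 2 * (norm (u - g))\<^sup>2 + 2 * (norm (v - g))\<^sup>2"
      by (simp add: power2_norm_eq_inner inner_diff_left inner_diff_right inner_add_left inner_add_right
          inner_commute algebra_simps)
    moreover have "c * E (u + v) (u + v) + c * E (u - v) (u - v) = 2 * (c * E u u) + 2 * (c * E v v)"
      using arg_cong[OF E_parallelogram[OF uv], of "(*) c"] by (simp only: distrib_left mult.left_commute)
    ultimately show ?thesis using mid unfolding dirichlet_functional_def by argo
  qed
  have small: "\<exists>N. \<forall>n\<ge>N. ?F (\<phi> n) - I < d" if "d > 0" for d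
    using LIMSEQ_D[OF min that] by (auto simp: abs_less_iff)
  have nn: "c * E (\<phi> i - \<phi> j) (\<phi> i - \<phi> j) \<ge> 0" for i j
    using c by (intro mult_nonneg_nonneg L_nonneg D_diff \<phi>) auto
  have "Cauchy \<phi>"
  proof (rule CauchyI)
    fix e :: real assume e: "e > 0"
    obtain N where N: "\<And>n. n \<ge> N \<Longrightarrow> ?F (\<phi> n) - I < e\<^sup>2 / 4"
      using small[of "e\<^sup>2 / 4"] e by auto
    have "norm (\<phi> i - \<phi> j) < e" if "i \<ge> N" "j \<ge> N" for i j
    proof -
      have "(norm (\<phi> i - \<phi> j))\<^sup>2 < e\<^sup>2"
        using par[OF \<phi> \<phi>, of i j] nn[of i j] N[OF that(1)] N[OF that(2)] by simp
      then show ?thesis using e by (simp add: power2_less_imp_less)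
    qed
    then show "\<exists>M. \<forall>m\<ge>M. \<forall>n\<ge>M. norm (\<phi> m - \<phi> n) < e" by blast
  qed
  then obtain f where f: "\<phi> \<longlonglongrightarrow> f" using Cauchy_convergent by (auto simp: convergent_def)
  have "\<exists>N. \<forall>i\<ge>N. \<forall>j\<ge>N. E (\<phi> i - \<phi> j) (\<phi> i - \<phi> j) < e" if e: "e > 0" for e
  proof -
    obtain N where N: "\<And>n. n \<ge> N \<Longrightarrow> ?F (\<phi> n) - I < c * e / 4"
      using small[of "c * e / 4"] e c by auto
    have "E (\<phi> i - \<phi> j) (\<phi> i - \<phi> j) < e" if "i \<ge> N" "j \<ge> N" for i j
    proof -
      have "0 \<le> (norm (\<phi> i - \<phi> j))\<^sup>2" by simp
      then have "c * E (\<phi> i - \<phi> j) (\<phi> i - \<phi> j) < c * e"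
        using par[OF \<phi> \<phi>, of i j] N[OF that(1)] N[OF that(2)] by argo
      then show ?thesis using c by simp
    qed
    then show ?thesis by blast
  qed
  with \<phi> f have ap: "approximates \<phi> f" by (simp add: approximates_def)
  define h where "h = (1 / c) *\<^sub>R (g - f)"
  have "f \<bullet> L v = h \<bullet> v" if v: "v \<in> D" for v
  proof -
    \<comment> \<open>the first variation of the functional at \<open>f\<close> in the direction \<open>v\<close>\<close>
    define l where "l = c * (f \<bullet> L v) + (f - g) \<bullet> v"
    define q where "q = c * E v v + (norm v)\<^sup>2"
    have q: "q \<ge> 0" using c L_nonneg[OF v] by (simp add: q_def)
    have var: "0 \<le> 2 * r * l + r\<^sup>2 * q" for r
    proof -
      have "?F (\<phi> n + r *\<^sub>R v)
          = ?F (\<phi> n) + 2 * r * (c * (\<phi> n \<bullet> L v) + (\<phi> n - g) \<bullet> v) + r\<^sup>2 * q" for n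
      proof -
        have "E (\<phi> n + r *\<^sub>R v) (\<phi> n + r *\<^sub>R v) = E (\<phi> n) (\<phi> n) + 2 * r * (\<phi> n \<bullet> L v) + r\<^sup>2 * E v v"
          using E_expand[OF \<phi> v] L_sym[OF \<phi> v] by simp
        moreover have "(norm (\<phi> n + r *\<^sub>R v - g))\<^sup>2
            = (norm (\<phi> n - g))\<^sup>2 + 2 * r * ((\<phi> n - g) \<bullet> v) + r\<^sup>2 * (norm v)\<^sup>2"
        proof -
          have "(norm (a + r *\<^sub>R v))\<^sup>2 = (norm a)\<^sup>2 + 2 * r * (a \<bullet> v) + r\<^sup>2 * (norm v)\<^sup>2" for a
            unfolding power2_norm_eq_inner inner_add_left inner_add_right inner_scaleR_left inner_scaleR_right
            by (simp add: inner_commute[of v a] power2_eq_square algebra_simps)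
          from this[of "\<phi> n - g"] show ?thesis by (simp add: algebra_simps)
        qed
        ultimately show ?thesis by (simp add: dirichlet_functional_def q_def algebra_simps)
      qed
      moreover have "I \<le> ?F (\<phi> n + r *\<^sub>R v)" for n by (intro I D_add D_scale \<phi> v)
      ultimately have "I \<le> ?F (\<phi> n) + 2 * r * (c * (\<phi> n \<bullet> L v) + (\<phi> n - g) \<bullet> v) + r\<^sup>2 * q" for n
        by metis
      moreover have "(\<lambda>n. ?F (\<phi> n) + 2 * r * (c * (\<phi> n \<bullet> L v) + (\<phi> n - g) \<bullet> v) + r\<^sup>2 * q)
          \<longlonglongrightarrow> I + 2 * r * l + r\<^sup>2 * q"
        unfolding l_def by (intro tendsto_intros f min)
      ultimately have "I \<le> I + 2 * r * l + r\<^sup>2 * q"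
        by (intro LIMSEQ_le_const[where a = I]) auto
      then show ?thesis by simp
    qed
    have "l = 0"
    proof -
      \<comment> \<open>this choice makes the variation equal to \<open>- r\<^sup>2 (q + 2)\<close>\<close>
      define r where "r = - l / (q + 1)"
      have l: "l = - (r * (q + 1))" using q by (simp add: r_def)
      have "2 * r * l + r\<^sup>2 * q = - (r\<^sup>2 * (q + 2))"
        unfolding l by (simp add: power2_eq_square algebra_simps)
      then have "r\<^sup>2 * (q + 2) \<le> 0" using var[of r] by simp
      then have "r\<^sup>2 \<le> 0" using q by (simp add: mult_le_0_iff)
      then have "r = 0" by simp
      then show ?thesis by (simp add: l)
    qed
    then have "c * (f \<bullet> L v) = (g - f) \<bullet> v" by (simp add: l_def inner_diff_left)
    moreover have "h \<bullet> v = (1 / c) * ((g - f) \<bullet> v)" by (simp only: h_def inner_scaleR_left)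
    ultimately have "c * (f \<bullet> L v) = c * (h \<bullet> v)" using c by simp
    then show ?thesis using c by simp
  qed
  then have "(f, h) \<in> friedrichs" using ap by (auto simp: friedrichs_iff form_dom_def)
  moreover have "f + c *\<^sub>R h = g" using c by (simp add: h_def)
  ultimately show ?thesis using that f by blast
qed

lemma minimizing_sequence_exists:
  assumes c: "c > 0"
  obtains \<phi> I where "\<And>n. \<phi> n \<in> D" "(\<lambda>n. dirichlet_functional c g (\<phi> n)) \<longlonglongrightarrow> I"
    "\<And>v. v \<in> D \<Longrightarrow> I \<le> dirichlet_functional c g v"
proof -
  let ?F = "dirichlet_functional c g"
  define I where "I = (INF v\<in>D. ?F v)"
  have ne: "D \<noteq> {}" using subspace_0[OF subspace_D] by auto
  have bdd: "bdd_below (?F ` D)"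
    using c by (intro bdd_belowI[of _ 0]) (auto simp: dirichlet_functional_def L_nonneg)
  have I: "I \<le> ?F v" if "v \<in> D" for v using cINF_lower[OF bdd that] by (simp add: I_def)
  have "\<exists>v\<in>D. ?F v < I + 1 / Suc n" for n
    using cINF_less_iff[OF ne bdd, of "I + 1 / Suc n"] by (simp add: I_def)
  then obtain \<phi> where \<phi>: "\<And>n. \<phi> n \<in> D" "\<And>n. ?F (\<phi> n) < I + 1 / Suc n" by metis
  have "(\<lambda>n. ?F (\<phi> n)) \<longlonglongrightarrow> I"
  proof (rule tendsto_sandwich[OF _ _ tendsto_const])
    show "(\<lambda>n. I + 1 / Suc n) \<longlonglongrightarrow> I"
      using tendsto_add[OF tendsto_const[of I] lim_1_over_n[THEN LIMSEQ_Suc]] by simp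
  qed (use I \<phi> in \<open>auto intro!: always_eventually less_imp_le\<close>)
  with \<phi> I show ?thesis using that by blast
qed

lemma friedrichs_resolvent_exists:
  assumes "c > 0"
  shows "\<exists>f h. (f, h) \<in> friedrichs \<and> f + c *\<^sub>R h = g"
  using minimizing_sequence_exists[OF assms] minimizing_sequence_limit[OF assms] by metis

text \<open>The Beurling-Deny argument: if a map of \<open>D\<close> into \<open>K\<close> lowers both parts of the functional,
  minimizing sequences may be taken in \<open>K\<close>.\<close>

lemma friedrichs_resolvent_in_closed:
  assumes c: "c > 0" and K: "closed K" "g \<in> K" and \<kappa>: "\<And>v. v \<in> D \<Longrightarrow> \<kappa> v \<in> D \<inter> K"
    and E_le: "\<And>v. v \<in> D \<Longrightarrow> E (\<kappa> v) (\<kappa> v) \<le> E v v"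
    and dist_le: "\<And>v u. v \<in> D \<Longrightarrow> u \<in> K \<Longrightarrow> norm (\<kappa> v - u) \<le> norm (v - u)"
  shows "\<exists>f h. (f, h) \<in> friedrichs \<and> f + c *\<^sub>R h = g \<and> f \<in> K"
proof -
  let ?F = "dirichlet_functional c g"
  obtain \<phi> I where \<phi>: "\<And>n. \<phi> n \<in> D" "(\<lambda>n. ?F (\<phi> n)) \<longlonglongrightarrow> I" and I: "\<And>v. v \<in> D \<Longrightarrow> I \<le> ?F v"
    using minimizing_sequence_exists[OF c, of g] by metis
  have le: "?F (\<kappa> (\<phi> n)) \<le> ?F (\<phi> n)" for n
    unfolding dirichlet_functional_def using c E_le[OF \<phi>(1)] dist_le[OF \<phi>(1) K(2)]
    by (intro add_mono mult_left_mono power_mono) auto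
  have \<kappa>D: "\<kappa> (\<phi> n) \<in> D" and \<kappa>K: "\<kappa> (\<phi> n) \<in> K" for n using \<kappa>[OF \<phi>(1)] by auto
  have lim: "(\<lambda>n. ?F (\<kappa> (\<phi> n))) \<longlonglongrightarrow> I"
    by (rule tendsto_sandwich[OF _ _ tendsto_const \<phi>(2)]) (simp_all add: I \<kappa>D le)
  obtain f h where f: "(\<lambda>n. \<kappa> (\<phi> n)) \<longlonglongrightarrow> f" "(f, h) \<in> friedrichs" "f + c *\<^sub>R h = g"
    using minimizing_sequence_limit[OF c \<kappa>D lim I] by blast
  have "f \<in> K" using closed_sequentially[OF K(1) \<kappa>K f(1)] .
  with f show ?thesis by blast
qed

end

section \<open>The Hilbert space of square summable functions\<close>

lemma square_summable_add:
  fixes f g :: "'a \<Rightarrow> real"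
  assumes "(\<lambda>x. (f x)\<^sup>2) summable_on A" "(\<lambda>x. (g x)\<^sup>2) summable_on A"
  shows "(\<lambda>x. (f x + g x)\<^sup>2) summable_on A"
proof (rule summable_on_comparison_test)
  show "(\<lambda>x. 2 * (f x)\<^sup>2 + 2 * (g x)\<^sup>2) summable_on A"
    by (intro summable_on_add summable_on_cmult_right assms)
  show "(f x + g x)\<^sup>2 \<le> 2 * (f x)\<^sup>2 + 2 * (g x)\<^sup>2" for x
    using sum_squares_bound[of "f x" "g x"] by (simp add: power2_sum)
qed simp

lemma square_summable_product:
  fixes f g :: "'a \<Rightarrow> real"
  assumes "(\<lambda>x. (f x)\<^sup>2) summable_on A" "(\<lambda>x. (g x)\<^sup>2) summable_on A"
  shows "(\<lambda>x. f x * g x) summable_on A"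
proof -
  have "(\<lambda>x. (1 / 2) * ((f x + g x)\<^sup>2 + (- 1) * ((f x)\<^sup>2 + (g x)\<^sup>2))) summable_on A"
    by (intro summable_on_add summable_on_cmult_right square_summable_add assms)
  moreover have "(1 / 2) * ((f x + g x)\<^sup>2 + (- 1) * ((f x)\<^sup>2 + (g x)\<^sup>2)) = f x * g x" for x
    by (simp add: power2_sum)
  ultimately show ?thesis by simp
qed

text \<open>A type is used so that the results on Banach and Hilbert spaces apply. The vertex measure is not
  part of it: multiplication by \<open>sqrt m\<close> will map the weighted space isometrically onto this one.\<close>

typedef 'a ell2 = "{f :: 'a \<Rightarrow> real. (\<lambda>x. (f x)\<^sup>2) summable_on UNIV}"
  morphisms ell2_apply Abs_ell2
  by (rule exI[of _ "\<lambda>_. 0"]) simp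

setup_lifting type_definition_ell2

lemma ell2_summable: "(\<lambda>x. (ell2_apply u x)\<^sup>2) summable_on UNIV"
  using ell2_apply[of u] by simp

lemma ell2_product_summable: "(\<lambda>x. ell2_apply u x * ell2_apply v x) summable_on UNIV"
  by (intro square_summable_product ell2_summable)

lemma ell2_eqI: "(\<And>x. ell2_apply u x = ell2_apply v x) \<Longrightarrow> u = v"
  by (simp add: ell2_apply_inject[symmetric] fun_eq_iff)

instantiation ell2 :: (type) real_vector
begin

lift_definition zero_ell2 :: "'a ell2" is "\<lambda>_. 0" by simp
lift_definition plus_ell2 :: "'a ell2 \<Rightarrow> 'a ell2 \<Rightarrow> 'a ell2" is "\<lambda>f g x. f x + g x"
  by (rule square_summable_add)
lift_definition uminus_ell2 :: "'a ell2 \<Rightarrow> 'a ell2" is "\<lambda>f x. - f x" by simp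
lift_definition minus_ell2 :: "'a ell2 \<Rightarrow> 'a ell2 \<Rightarrow> 'a ell2" is "\<lambda>f g x. f x - g x"
  using square_summable_add[of _ UNIV "\<lambda>x. - _ x"] by simp
lift_definition scaleR_ell2 :: "real \<Rightarrow> 'a ell2 \<Rightarrow> 'a ell2" is "\<lambda>r f x. r * f x"
  by (simp add: power_mult_distrib summable_on_cmult_right)

instance
  by standard (transfer, simp add: algebra_simps fun_eq_iff)+

end

lemmas ell2_apply_simps [simp] =
  zero_ell2.rep_eq plus_ell2.rep_eq uminus_ell2.rep_eq minus_ell2.rep_eq scaleR_ell2.rep_eq

instantiation ell2 :: (type) real_inner
begin

definition inner_ell2 :: "'a ell2 \<Rightarrow> 'a ell2 \<Rightarrow> real" where
  "inner_ell2 u v = (\<Sum>\<^sub>\<infinity>x. ell2_apply u x * ell2_apply v x)"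
definition norm_ell2 :: "'a ell2 \<Rightarrow> real" where
  "norm_ell2 u = sqrt (inner u u)"
definition dist_ell2 :: "'a ell2 \<Rightarrow> 'a ell2 \<Rightarrow> real" where
  "dist_ell2 u v = norm (u - v)"
definition sgn_ell2 :: "'a ell2 \<Rightarrow> 'a ell2" where
  "sgn_ell2 u = u /\<^sub>R norm u"
definition uniformity_ell2 :: "('a ell2 \<times> 'a ell2) filter" where
  "uniformity_ell2 = (INF e\<in>{0<..}. principal {(u, v). dist u v < e})"
definition open_ell2 :: "'a ell2 set \<Rightarrow> bool" where
  "open_ell2 S = (\<forall>u\<in>S. \<forall>\<^sub>F (u', v) in uniformity. u' = u \<longrightarrow> v \<in> S)"

instance
proof
  fix u v w :: "'a ell2" and r :: real
  show "inner u v = inner v u" by (simp add: inner_ell2_def mult.commute)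
  show "inner (u + v) w = inner u w + inner v w"
    unfolding inner_ell2_def by (simp add: distrib_right infsum_add ell2_product_summable)
  show "inner (r *\<^sub>R u) v = r * inner u v"
    unfolding inner_ell2_def by (simp add: mult.assoc infsum_cmult_right')
  show "0 \<le> inner u u" unfolding inner_ell2_def by (simp add: infsum_nonneg)
  show "inner u u = 0 \<longleftrightarrow> u = 0"
  proof
    assume 0: "inner u u = 0"
    have "ell2_apply u x * ell2_apply u x = 0" for x
      using nonneg_infsum_le_0D[of "\<lambda>x. ell2_apply u x * ell2_apply u x" UNIV x]
        ell2_product_summable[of u u] 0 by (auto simp: inner_ell2_def)
    then show "u = 0" by (intro ell2_eqI) simp
  qed (simp add: inner_ell2_def)
qed (simp_all add: norm_ell2_def dist_ell2_def sgn_ell2_def uniformity_ell2_def open_ell2_def)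

end

lemma norm_ell2_square: "(norm u)\<^sup>2 = (\<Sum>\<^sub>\<infinity>x. (ell2_apply u x)\<^sup>2)"
  unfolding power2_norm_eq_inner by (simp add: inner_ell2_def power2_eq_square)

lemma sum_le_norm_ell2:
  assumes "finite F"
  shows "(\<Sum>x\<in>F. (ell2_apply u x)\<^sup>2) \<le> (norm u)\<^sup>2"
  unfolding norm_ell2_square by (intro finite_sum_le_infsum ell2_summable assms) auto

lemma norm_ell2_mono:
  assumes "\<And>x. \<bar>ell2_apply u x\<bar> \<le> \<bar>ell2_apply v x\<bar>"
  shows "norm u \<le> norm v"
proof -
  have "(norm u)\<^sup>2 \<le> (norm v)\<^sup>2"
    unfolding norm_ell2_square using assms
    by (intro infsum_mono ell2_summable) (simp add: abs_le_square_iff)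
  then show ?thesis by (rule power2_le_imp_le) simp
qed

text \<open>Each point of the set contributes at least \<open>d\<^sup>2\<close> to the squared norm.\<close>

lemma finite_ell2_superlevel:
  assumes d: "d > 0"
  shows "finite {x. \<bar>ell2_apply u x\<bar> > d}"
proof (rule ccontr)
  assume inf: "infinite {x. \<bar>ell2_apply u x\<bar> > d}"
  obtain n :: nat where n: "(norm u)\<^sup>2 / d\<^sup>2 < n" using reals_Archimedean2 by blast
  obtain F where F: "finite F" "card F = n" "F \<subseteq> {x. \<bar>ell2_apply u x\<bar> > d}"
    using infinite_arbitrarily_large[OF inf] by metis
  have "n * d\<^sup>2 = (\<Sum>x\<in>F. d\<^sup>2)" by (simp add: F)
  also have "\<dots> \<le> (\<Sum>x\<in>F. (ell2_apply u x)\<^sup>2)"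
    using F(3) d by (intro sum_mono) (auto simp: abs_le_square_iff[symmetric])
  also have "\<dots> \<le> (norm u)\<^sup>2" by (rule sum_le_norm_ell2[OF F(1)])
  finally show False using n d by (simp add: field_simps)
qed

lemma abs_ell2_apply_le_norm: "\<bar>ell2_apply u x\<bar> \<le> norm u"
  using sum_le_norm_ell2[of "{x}" u] by (simp add: abs_le_square_iff[symmetric])

lemma bounded_linear_ell2_apply: "bounded_linear (\<lambda>u. ell2_apply u x)"
  by (rule bounded_linear_intro[where K = 1]) (auto simp: abs_ell2_apply_le_norm)

text \<open>Completeness is proved by passing to pointwise limits in finite partial sums; this turns a bound
  on these sums into an element of the space.\<close>

lemma ell2_of_bounded_sums:
  assumes "\<And>F. finite F \<Longrightarrow> (\<Sum>x\<in>F. (f x)\<^sup>2) \<le> B"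
  shows "\<exists>u. ell2_apply u = f \<and> (norm u)\<^sup>2 \<le> B"
proof -
  have s: "(\<lambda>x. (f x)\<^sup>2) summable_on UNIV"
    by (rule nonneg_bdd_above_summable_on) (auto intro!: bdd_aboveI[of _ B] assms)
  define u where "u = Abs_ell2 f"
  have u: "ell2_apply u = f" using s by (simp add: u_def Abs_ell2_inverse)
  have "(\<Sum>\<^sub>\<infinity>x. (f x)\<^sup>2) \<le> B" by (intro infsum_le_finite_sums s assms) auto
  then show ?thesis using u by (intro exI[of _ u]) (simp add: norm_ell2_square)
qed

instance ell2 :: (type) banach
proof
  fix X :: "nat \<Rightarrow> 'a ell2"
  assume X: "Cauchy X"
  have "convergent (\<lambda>n. ell2_apply (X n) x)" for x
    by (intro Cauchy_convergent bounded_linear.Cauchy[OF bounded_linear_ell2_apply X])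
  then obtain f where f: "\<And>x. (\<lambda>n. ell2_apply (X n) x) \<longlonglongrightarrow> f x"
    unfolding convergent_def by metis
  have close: "\<exists>N. \<forall>n\<ge>N. \<forall>F. finite F \<longrightarrow> (\<Sum>x\<in>F. (ell2_apply (X n) x - f x)\<^sup>2) \<le> e\<^sup>2" if e: "e > 0" for e
  proof -
    obtain N where N: "\<And>i j. i \<ge> N \<Longrightarrow> j \<ge> N \<Longrightarrow> norm (X i - X j) < e"
      using CauchyD[OF X e] by blast
    have "(\<Sum>x\<in>F. (ell2_apply (X n) x - f x)\<^sup>2) \<le> e\<^sup>2" if n: "n \<ge> N" and F: "finite F" for n F
    proof (rule LIMSEQ_le_const2)
      show "(\<lambda>k. \<Sum>x\<in>F. (ell2_apply (X n) x - ell2_apply (X k) x)\<^sup>2) \<longlonglongrightarrow> (\<Sum>x\<in>F. (ell2_apply (X n) x - f x)\<^sup>2)"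
        by (intro tendsto_intros f)
      have "(\<Sum>x\<in>F. (ell2_apply (X n) x - ell2_apply (X k) x)\<^sup>2) \<le> e\<^sup>2" if k: "k \<ge> N" for k
      proof -
        have "(\<Sum>x\<in>F. (ell2_apply (X n) x - ell2_apply (X k) x)\<^sup>2) \<le> (norm (X n - X k))\<^sup>2"
          using sum_le_norm_ell2[OF F, of "X n - X k"] by simp
        also have "\<dots> \<le> e\<^sup>2" using N[OF n k] by (intro power_mono) auto
        finally show ?thesis .
      qed
      then show "\<exists>N. \<forall>k\<ge>N. (\<Sum>x\<in>F. (ell2_apply (X n) x - ell2_apply (X k) x)\<^sup>2) \<le> e\<^sup>2" by blast
    qed
    then show ?thesis by blast
  qed
  have "\<exists>u. ell2_apply u = f"
  proof -
    obtain N where "\<And>F. finite F \<Longrightarrow> (\<Sum>x\<in>F. (ell2_apply (X N) x - f x)\<^sup>2) \<le> 1"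
      using close[of 1] by auto
    then obtain w where w: "ell2_apply w = (\<lambda>x. ell2_apply (X N) x - f x)"
      using ell2_of_bounded_sums[of "\<lambda>x. ell2_apply (X N) x - f x" 1] by blast
    have "ell2_apply (X N - w) = f" by (simp add: w)
    then show ?thesis by blast
  qed
  then obtain u where u: "ell2_apply u = f" by blast
  have "X \<longlonglongrightarrow> u"
  proof (rule LIMSEQ_I)
    fix e :: real assume e: "e > 0"
    obtain N where N: "\<And>n F. n \<ge> N \<Longrightarrow> finite F \<Longrightarrow> (\<Sum>x\<in>F. (ell2_apply (X n) x - f x)\<^sup>2) \<le> (e / 2)\<^sup>2"
      using close[of "e / 2"] e by auto
    have "norm (X n - u) < e" if n: "n \<ge> N" for n
    proof -
      obtain w where w: "ell2_apply w = (\<lambda>x. ell2_apply (X n) x - f x)" "(norm w)\<^sup>2 \<le> (e / 2)\<^sup>2"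
        using ell2_of_bounded_sums[of "\<lambda>x. ell2_apply (X n) x - f x" "(e / 2)\<^sup>2"] N[OF n] by blast
      have "w = X n - u" by (rule ell2_eqI) (simp add: w u)
      moreover have "norm w \<le> e / 2" using power2_le_imp_le[OF w(2)] e by simp
      ultimately show ?thesis using e by simp
    qed
    then show "\<exists>N. \<forall>n\<ge>N. norm (X n - u) < e" by blast
  qed
  then show "convergent X" by (auto simp: convergent_def)
qed

lemma finite_support_dense_ell2: "closure {u :: 'a ell2. finite {x. ell2_apply u x \<noteq> 0}} = UNIV"
proof -
  have "\<exists>v. finite {x. ell2_apply v x \<noteq> 0} \<and> dist v u < e" if e: "e > 0" for u :: "'a ell2" and e
  proof -
    have e4: "(e / 2)\<^sup>2 > 0" using e by simp
    obtain F where F: "finite F" "dist (\<Sum>x\<in>F. (ell2_apply u x)\<^sup>2) (\<Sum>\<^sub>\<infinity>x. (ell2_apply u x)\<^sup>2) \<le> (e / 2)\<^sup>2"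
      using infsum_finite_approximation[OF ell2_summable e4, of u] by auto
    define g where "g x = (if x \<in> F then 0 else ell2_apply u x)" for x
    have "(\<Sum>x\<in>G. (g x)\<^sup>2) \<le> (e / 2)\<^sup>2" if G: "finite G" for G
    proof -
      have "(\<Sum>x\<in>G. (g x)\<^sup>2) = (\<Sum>x\<in>G - F. (ell2_apply u x)\<^sup>2)"
        using G by (intro sum.mono_neutral_cong_right) (auto simp: g_def)
      also have "\<dots> = (\<Sum>x\<in>F \<union> (G - F). (ell2_apply u x)\<^sup>2) - (\<Sum>x\<in>F. (ell2_apply u x)\<^sup>2)"
        using F(1) G by (subst sum.union_disjoint) auto
      also have "\<dots> \<le> (\<Sum>\<^sub>\<infinity>x. (ell2_apply u x)\<^sup>2) - (\<Sum>x\<in>F. (ell2_apply u x)\<^sup>2)"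
        using sum_le_norm_ell2[of "F \<union> (G - F)" u] F(1) G by (simp add: norm_ell2_square)
      also have "\<dots> \<le> (e / 2)\<^sup>2" using F(2) by (simp add: dist_real_def abs_le_iff)
      finally show ?thesis .
    qed
    then obtain w where w: "ell2_apply w = g" "(norm w)\<^sup>2 \<le> (e / 2)\<^sup>2"
      using ell2_of_bounded_sums[of g "(e / 2)\<^sup>2"] by blast
    have "{x. ell2_apply (u - w) x \<noteq> 0} \<subseteq> F" by (auto simp: w g_def)
    then have "finite {x. ell2_apply (u - w) x \<noteq> 0}" using F(1) finite_subset by blast
    moreover have "norm w \<le> e / 2" using power2_le_imp_le[OF w(2)] e by simp
    then have "dist (u - w) u < e" using e by (simp add: dist_norm)
    ultimately show ?thesis by blast
  qed
  then show ?thesis by (auto simp: closure_approachable)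
qed

section \<open>The heat semigroup of a nonnegative symmetric operator\<close>

context nonneg_symmetric_operator
begin

definition heat_generator :: "('a \<times> 'a) set" where
  "heat_generator = {(f, h). (f, - h) \<in> friedrichs}"

sublocale heat: m_dissipative heat_generator
proof
  show "subspace heat_generator"
    unfolding subspace_def
  proof (intro conjI ballI allI)
    show "0 \<in> heat_generator"
      using subspace_0[OF subspace_friedrichs] by (simp add: heat_generator_def zero_prod_def)
    fix p assume p: "p \<in> heat_generator"
    show "p + q \<in> heat_generator" if "q \<in> heat_generator" for q
      using p that subspace_add[OF subspace_friedrichs, of "(fst p, - snd p)" "(fst q, - snd q)"]
      by (cases p; cases q) (simp add: heat_generator_def)
    show "r *\<^sub>R p \<in> heat_generator" for r
      using p subspace_scale[OF subspace_friedrichs, of "(fst p, - snd p)" r]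
      by (cases p) (simp add: heat_generator_def)
  qed
  show "norm f \<le> norm (f - c *\<^sub>R h)" if fh: "(f, h) \<in> heat_generator" and c: "c > 0" for f h c
  proof -
    have "h \<bullet> f \<le> 0" using friedrichs_nonneg[of f "- h"] fh by (simp add: heat_generator_def)
    then have "2 * c * (h \<bullet> f) \<le> 0" using c by (intro mult_nonneg_nonpos) auto
    moreover have "0 \<le> c\<^sup>2 * (h \<bullet> h)" by simp
    ultimately have "0 \<le> - (2 * c * (h \<bullet> f)) + c\<^sup>2 * (h \<bullet> h)" by linarith
    also have "\<dots> = (norm (f - c *\<^sub>R h))\<^sup>2 - (norm f)\<^sup>2"
      unfolding power2_norm_eq_inner inner_diff_left inner_diff_right inner_scaleR_left inner_scaleR_right
      by (simp add: inner_commute[of f h] power2_eq_square right_diff_distrib)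
    finally have "(norm f)\<^sup>2 \<le> (norm (f - c *\<^sub>R h))\<^sup>2" by simp
    then show ?thesis by (rule power2_le_imp_le) simp
  qed
  show "\<exists>f h. (f, h) \<in> heat_generator \<and> f - c *\<^sub>R h = g" if c: "c > 0" for c g
  proof -
    obtain f h where fh: "(f, h) \<in> friedrichs" "f + c *\<^sub>R h = g"
      using friedrichs_resolvent_exists[OF c] by blast
    then show ?thesis by (intro exI[of _ f] exI[of _ "- h"]) (simp add: heat_generator_def)
  qed
  have "D \<subseteq> fst ` heat_generator"
  proof
    fix v assume "v \<in> D"
    then have "(v, - L v) \<in> heat_generator" by (simp add: heat_generator_def friedrichs_extends)
    then show "v \<in> fst ` heat_generator" by force
  qed
  then show "closure (fst ` heat_generator) = UNIV"
    using closure_mono dense_D by blast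
qed

text \<open>The invariance of \<open>K\<close> passes from the variational problem to the resolvents and on to the
  semigroup.\<close>

lemma heat_P_in_closed:
  assumes K: "closed K" and \<kappa>: "\<And>v. v \<in> D \<Longrightarrow> \<kappa> v \<in> D \<inter> K"
    and E_le: "\<And>v. v \<in> D \<Longrightarrow> E (\<kappa> v) (\<kappa> v) \<le> E v v"
    and dist_le: "\<And>v u. v \<in> D \<Longrightarrow> u \<in> K \<Longrightarrow> norm (\<kappa> v - u) \<le> norm (v - u)"
    and "t \<ge> 0" "g \<in> K"
  shows "heat.P t g \<in> K"
proof (rule heat.P_in_closed[OF K _ \<open>t \<ge> 0\<close> \<open>g \<in> K\<close>])
  fix c :: real and g assume c: "c > 0" and g: "g \<in> K"
  obtain f h where f: "(f, h) \<in> friedrichs" "f + c *\<^sub>R h = g" "f \<in> K"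
    using friedrichs_resolvent_in_closed[OF c K g \<kappa> E_le dist_le] by blast
  have "(f, - h) \<in> heat_generator" using f by (simp add: heat_generator_def)
  from heat.J_eq[OF this, of c] f c show "heat.J c g \<in> K" by simp
qed

end

section \<open>Functions vanishing at infinity\<close>

text \<open>This criterion replaces uniform approximation by finitely supported functions.\<close>

lemma vanishing_at_infinity_iff:
  "f \<in> vanishing_at_infinity \<longleftrightarrow> (\<forall>e>0. finite {x. \<bar>f x\<bar> > e})"
proof (intro iffI allI impI)
  fix e :: real assume "f \<in> vanishing_at_infinity" and e: "e > 0"
  then obtain \<phi> where \<phi>: "\<And>n. \<phi> n \<in> fin_supp" and lim: "uniform_limit UNIV \<phi> f sequentially"
    by (auto simp: vanishing_at_infinity_def)
  obtain n where n: "\<And>x. dist (\<phi> n x) (f x) < e"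
    using uniform_limitD[OF lim e] by (auto simp: eventually_sequentially)
  have "{x. \<bar>f x\<bar> > e} \<subseteq> {x. \<phi> n x \<noteq> 0}"
  proof safe
    fix x assume "\<bar>f x\<bar> > e" "\<phi> n x = 0"
    with n[of x] show False by (simp add: dist_real_def)
  qed
  then show "finite {x. \<bar>f x\<bar> > e}" using \<phi>[of n] finite_subset by (auto simp: fin_supp_def)
next
  assume fin: "\<forall>e>0. finite {x. \<bar>f x\<bar> > e}"
  define \<phi> where "\<phi> n x = (if \<bar>f x\<bar> > 1 / Suc n then f x else 0)" for n x
  have "\<phi> n \<in> fin_supp" for n
  proof -
    have "finite {x. \<bar>f x\<bar> > 1 / Suc n}" using fin by simp
    then have "finite {x. \<phi> n x \<noteq> 0}" by (rule rev_finite_subset) (auto simp: \<phi>_def)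
    then show ?thesis by (simp add: fin_supp_def)
  qed
  moreover have "uniform_limit UNIV \<phi> f sequentially"
  proof (rule uniform_limitI)
    fix e :: real assume e: "e > 0"
    obtain N where N: "1 / Suc N < e" using e nat_approx_posE by blast
    have "dist (\<phi> n x) (f x) < e" if "n \<ge> N" for n x
    proof -
      have "dist (\<phi> n x) (f x) \<le> 1 / Suc n" by (auto simp: \<phi>_def dist_real_def)
      also have "\<dots> \<le> 1 / Suc N" using that by (simp add: frac_le)
      finally show ?thesis using N by simp
    qed
    then show "\<forall>\<^sub>F n in sequentially. \<forall>x\<in>UNIV. dist (\<phi> n x) (f x) < e"
      by (auto simp: eventually_sequentially)
  qed
  ultimately show "f \<in> vanishing_at_infinity" by (auto simp: vanishing_at_infinity_def)
qed

lemma vanishing_at_infinity_closed: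
  assumes "\<And>e. e > 0 \<Longrightarrow> \<exists>g\<in>vanishing_at_infinity. \<forall>x. \<bar>f x - g x\<bar> \<le> e"
  shows "f \<in> vanishing_at_infinity"
  unfolding vanishing_at_infinity_iff
proof (intro allI impI)
  fix e :: real assume e: "e > 0"
  obtain g where g: "g \<in> vanishing_at_infinity" "\<And>x. \<bar>f x - g x\<bar> \<le> e / 2"
    using assms[of "e / 2"] e by auto
  have "finite {x. \<bar>g x\<bar> > e / 2}"
    using g(1) half_gt_zero[OF e] unfolding vanishing_at_infinity_iff by blast
  moreover have "{x. \<bar>f x\<bar> > e} \<subseteq> {x. \<bar>g x\<bar> > e / 2}"
  proof safe
    fix x assume "\<bar>f x\<bar> > e"
    with g(2)[of x] show "\<bar>g x\<bar> > e / 2" by linarith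
  qed
  ultimately show "finite {x. \<bar>f x\<bar> > e}" by (rule rev_finite_subset)
qed

lemma vanishing_at_infinity_bounded:
  assumes "f \<in> vanishing_at_infinity"
  obtains B where "B > 0" "\<And>x. \<bar>f x\<bar> \<le> B"
proof -
  have fin: "finite {x. \<bar>f x\<bar> > 1}" using assms by (simp add: vanishing_at_infinity_iff)
  define B where "B = Max (insert 1 ((\<lambda>x. \<bar>f x\<bar>) ` {x. \<bar>f x\<bar> > 1}))"
  have "1 \<le> B" unfolding B_def using fin by (intro Max_ge) auto
  moreover have "\<bar>f x\<bar> \<le> B" for x
  proof (cases "\<bar>f x\<bar> > 1")
    case True
    then show ?thesis unfolding B_def using fin by (intro Max_ge) auto
  qed (use \<open>1 \<le> B\<close> in simp)
  ultimately show ?thesis using that[of B] by simp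
qed

lemma fin_supp_vanishing: "\<phi> \<in> fin_supp \<Longrightarrow> \<phi> \<in> vanishing_at_infinity"
  unfolding vanishing_at_infinity_iff fin_supp_def by (auto elim!: rev_finite_subset)

section \<open>The graph Laplacian as an operator on the Hilbert space\<close>

context weighted_graph
begin

definition to_ell2 :: "('a \<Rightarrow> real) \<Rightarrow> 'a ell2" where
  "to_ell2 f = Abs_ell2 (\<lambda>x. f x * sqrt (m x))"

definition of_ell2 :: "'a ell2 \<Rightarrow> 'a \<Rightarrow> real" where
  "of_ell2 u x = ell2_apply u x / sqrt (m x)"

lemma m_simps [simp]: "sqrt (m x) > 0" "m x \<noteq> 0" "m x > 0" "m x \<ge> 0"
  using m_pos[of x] by (auto intro: less_imp_le)

lemma l2_iff: "f \<in> l2 m \<longleftrightarrow> (\<lambda>x. (f x * sqrt (m x))\<^sup>2) summable_on UNIV"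
  by (simp add: l2_def power_mult_distrib)

lemma to_ell2_apply: "f \<in> l2 m \<Longrightarrow> ell2_apply (to_ell2 f) x = f x * sqrt (m x)"
  by (simp add: to_ell2_def Abs_ell2_inverse l2_iff)

lemma of_ell2_in_l2 [simp]: "of_ell2 u \<in> l2 m"
  using ell2_summable[of u] by (simp add: l2_iff of_ell2_def)

lemma to_of_ell2 [simp]: "to_ell2 (of_ell2 u) = u"
  by (rule ell2_eqI) (simp add: to_ell2_apply, simp add: of_ell2_def)

lemma of_to_ell2: "f \<in> l2 m \<Longrightarrow> of_ell2 (to_ell2 f) = f"
  by (auto simp: of_ell2_def to_ell2_apply)

lemma of_ell2_add: "of_ell2 (u + v) = (\<lambda>x. of_ell2 u x + of_ell2 v x)"
  and of_ell2_diff: "of_ell2 (u - v) = (\<lambda>x. of_ell2 u x - of_ell2 v x)"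
  and of_ell2_scale: "of_ell2 (r *\<^sub>R u) = (\<lambda>x. r * of_ell2 u x)"
  by (auto simp: of_ell2_def add_divide_distrib diff_divide_distrib)

lemma to_ell2_eq_iff: "f \<in> l2 m \<Longrightarrow> to_ell2 f = u \<longleftrightarrow> f = of_ell2 u"
  using of_to_ell2 by auto

lemma to_ell2_lincomb:
  assumes "f \<in> l2 m" "g \<in> l2 m"
  shows "(\<lambda>x. c * f x + d * g x) \<in> l2 m" "to_ell2 (\<lambda>x. c * f x + d * g x) = c *\<^sub>R to_ell2 f + d *\<^sub>R to_ell2 g"
proof -
  have eq: "of_ell2 (c *\<^sub>R to_ell2 f + d *\<^sub>R to_ell2 g) = (\<lambda>x. c * f x + d * g x)"
    by (simp add: of_ell2_add of_ell2_scale of_to_ell2 assms)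
  show "(\<lambda>x. c * f x + d * g x) \<in> l2 m" using of_ell2_in_l2[of "c *\<^sub>R to_ell2 f + d *\<^sub>R to_ell2 g"] eq by simp
  show "to_ell2 (\<lambda>x. c * f x + d * g x) = c *\<^sub>R to_ell2 f + d *\<^sub>R to_ell2 g"
    using to_of_ell2[of "c *\<^sub>R to_ell2 f + d *\<^sub>R to_ell2 g"] eq by simp
qed

lemma to_ell2_diff:
  assumes "f \<in> l2 m" "g \<in> l2 m"
  shows "(\<lambda>x. f x - g x) \<in> l2 m" "to_ell2 (\<lambda>x. f x - g x) = to_ell2 f - to_ell2 g"
  using to_ell2_lincomb[OF assms, of 1 "-1"] by simp_all

lemma inner_to_ell2: "f \<in> l2 m \<Longrightarrow> g \<in> l2 m \<Longrightarrow> inner (to_ell2 f) (to_ell2 g) = l2_inner m f g"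
  unfolding inner_ell2_def l2_inner_def by (intro infsum_cong) (simp add: to_ell2_apply)

lemma l2_norm_eq: "f \<in> l2 m \<Longrightarrow> l2_norm m f = norm (to_ell2 f)"
  by (simp add: l2_norm_def norm_eq_sqrt_inner inner_to_ell2)

lemma fin_supp_l2: "f \<in> fin_supp \<Longrightarrow> f \<in> l2 m"
proof -
  assume "f \<in> fin_supp"
  then have "(\<lambda>x. (f x)\<^sup>2 * m x) summable_on {x. f x \<noteq> 0}"
    by (intro summable_on_finite) (simp add: fin_supp_def)
  also have "?this \<longleftrightarrow> (\<lambda>x. (f x)\<^sup>2 * m x) summable_on UNIV"
    by (rule summable_on_cong_neutral) auto
  finally show ?thesis by (simp add: l2_def)
qed

text \<open>By local finiteness a finitely supported function meets finitely many edges.\<close>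

lemma finite_edge_support:
  assumes "f \<in> fin_supp"
  shows "finite {(x, y). b x y \<noteq> 0 \<and> (f x \<noteq> 0 \<or> f y \<noteq> 0)}"
proof -
  let ?S = "{x. f x \<noteq> 0}"
  have S: "finite ?S" using assms by (simp add: fin_supp_def)
  have N: "finite {y. b x y \<noteq> 0}" for x
  proof -
    have "{y. b x y \<noteq> 0} = {y. b x y > 0}" using b_nonneg by (auto simp: less_le)
    then show ?thesis using locally_finite by simp
  qed
  have "{(x, y). b x y \<noteq> 0 \<and> (f x \<noteq> 0 \<or> f y \<noteq> 0)}
      \<subseteq> (SIGMA x:?S. {y. b x y \<noteq> 0}) \<union> prod.swap ` (SIGMA x:?S. {y. b x y \<noteq> 0})"
    using b_sym by (auto simp: image_iff)
  moreover have "finite ((SIGMA x:?S. {y. b x y \<noteq> 0}) \<union> prod.swap ` (SIGMA x:?S. {y. b x y \<noteq> 0}))"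
    using S N by (intro finite_UnI finite_imageI finite_SigmaI) auto
  ultimately show ?thesis by (rule finite_subset)
qed

lemma formal_laplacian_sum:
  "formal_laplacian b m f x = (\<Sum>y | b x y > 0. b x y * (f x - f y)) / m x"
proof -
  have "(\<Sum>\<^sub>\<infinity>y. b x y * (f x - f y)) = (\<Sum>\<^sub>\<infinity>y\<in>{y. b x y > 0}. b x y * (f x - f y))"
    using b_nonneg by (intro infsum_cong_neutral) (auto simp: less_le)
  then show ?thesis using locally_finite[of x] by (simp add: formal_laplacian_def)
qed

text \<open>Since finitely supported functions are mapped into the Hilbert space, the energy on them is the
  form of an operator, as required for the abstract Friedrichs extension.\<close>

lemma formal_laplacian_fin_supp:
  assumes "f \<in> fin_supp"
  shows "formal_laplacian b m f \<in> fin_supp"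
proof -
  let ?T = "fst ` {(x, y). b x y \<noteq> 0 \<and> (f x \<noteq> 0 \<or> f y \<noteq> 0)}"
  have "formal_laplacian b m f x = 0" if "x \<notin> ?T" for x
  proof -
    have "(\<Sum>\<^sub>\<infinity>y. b x y * (f x - f y)) = 0"
      by (rule infsum_0) (use that in \<open>auto simp: image_iff\<close>)
    then show ?thesis by (simp add: formal_laplacian_def)
  qed
  then have "{x. formal_laplacian b m f x \<noteq> 0} \<subseteq> ?T" by blast
  then show ?thesis
    using finite_edge_support[OF assms] finite_subset unfolding fin_supp_def by blast
qed

definition finitely_supported :: "'a ell2 set" where
  "finitely_supported = {u. finite {x. ell2_apply u x \<noteq> 0}}"

definition graph_laplacian :: "'a ell2 \<Rightarrow> 'a ell2" where
  "graph_laplacian u = to_ell2 (formal_laplacian b m (of_ell2 u))"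

lemma finitely_supported_iff: "u \<in> finitely_supported \<longleftrightarrow> of_ell2 u \<in> fin_supp"
  by (simp add: finitely_supported_def fin_supp_def of_ell2_def)

lemma of_ell2_graph_laplacian: "u \<in> finitely_supported \<Longrightarrow> of_ell2 (graph_laplacian u) = formal_laplacian b m (of_ell2 u)"
  by (simp add: graph_laplacian_def of_to_ell2 fin_supp_l2 formal_laplacian_fin_supp finitely_supported_iff)

lemma subspace_finitely_supported: "subspace finitely_supported"
  unfolding subspace_def
proof (intro conjI ballI allI)
  fix u v :: "'a ell2" assume u: "u \<in> finitely_supported"
  show "r *\<^sub>R u \<in> finitely_supported" for r
    using u unfolding finitely_supported_def by (auto elim!: rev_finite_subset)
  assume v: "v \<in> finitely_supported"
  have "{x. ell2_apply (u + v) x \<noteq> 0} \<subseteq> {x. ell2_apply u x \<noteq> 0} \<union> {x. ell2_apply v x \<noteq> 0}" by auto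
  then show "u + v \<in> finitely_supported"
    using u v unfolding finitely_supported_def by (auto elim!: rev_finite_subset[rotated])
qed (simp add: finitely_supported_def)

lemma inner_graph_laplacian:
  assumes "u \<in> finitely_supported" "v \<in> finitely_supported"
  shows "inner (graph_laplacian u) v = energy b (of_ell2 u) (of_ell2 v)"
proof -
  have "formal_laplacian b m (of_ell2 u) \<in> l2 m"
    using assms(1) by (simp add: finitely_supported_iff formal_laplacian_fin_supp fin_supp_l2)
  from inner_to_ell2[OF this, of "of_ell2 v"] show ?thesis
    using assms by (simp add: graph_laplacian_def energy_eq_formal_laplacian finitely_supported_iff)
qed

sublocale G: nonneg_symmetric_operator finitely_supported graph_laplacian
proof
  show "subspace finitely_supported" by (rule subspace_finitely_supported)
  show "closure finitely_supported = UNIV" unfolding finitely_supported_def by (rule finite_support_dense_ell2)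
  fix u v :: "'a ell2" assume u: "u \<in> finitely_supported"
  have inj: "u = v" if "of_ell2 u = of_ell2 v" for u v using to_of_ell2 that by metis
  show "graph_laplacian (r *\<^sub>R u) = r *\<^sub>R graph_laplacian u" for r
  proof (rule inj)
    have "r *\<^sub>R u \<in> finitely_supported" using u subspace_finitely_supported by (simp add: subspace_scale)
    then show "of_ell2 (graph_laplacian (r *\<^sub>R u)) = of_ell2 (r *\<^sub>R graph_laplacian u)"
      by (simp add: of_ell2_graph_laplacian of_ell2_scale u formal_laplacian_sum[abs_def] sum_distrib_left algebra_simps)
  qed
  show "0 \<le> inner (graph_laplacian u) u"
    unfolding inner_graph_laplacian[OF u u] energy_def using b_nonneg
    by (auto intro!: infsum_nonneg simp: mult.assoc)
  assume v: "v \<in> finitely_supported"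
  show "graph_laplacian (u + v) = graph_laplacian u + graph_laplacian v"
  proof (rule inj)
    have "u + v \<in> finitely_supported" using u v subspace_finitely_supported by (simp add: subspace_add)
    then show "of_ell2 (graph_laplacian (u + v)) = of_ell2 (graph_laplacian u + graph_laplacian v)"
      by (simp add: of_ell2_graph_laplacian of_ell2_add u v formal_laplacian_sum[abs_def] add_divide_distrib[symmetric]
          sum.distrib[symmetric] algebra_simps)
  qed
  have "energy b (of_ell2 u) (of_ell2 v) = energy b (of_ell2 v) (of_ell2 u)" unfolding energy_def by (simp add: mult_ac)
  then show "inner (graph_laplacian u) v = inner u (graph_laplacian v)"
    using inner_graph_laplacian[OF u v] inner_graph_laplacian[OF v u] by (simp add: inner_commute)
qed

lemma to_ell2_in_finitely_supported: "\<phi> \<in> fin_supp \<Longrightarrow> to_ell2 \<phi> \<in> finitely_supported"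
  by (simp add: finitely_supported_iff of_to_ell2 fin_supp_l2)

lemma E_to_ell2:
  "\<phi> \<in> fin_supp \<Longrightarrow> \<psi> \<in> fin_supp \<Longrightarrow> G.E (to_ell2 \<phi>) (to_ell2 \<psi>) = energy b \<phi> \<psi>"
  by (simp add: inner_graph_laplacian to_ell2_in_finitely_supported of_to_ell2 fin_supp_l2)

text \<open>From here to \<open>laplacian_iff\<close>, the concrete closed form and its operator are identified with the
  abstract ones.\<close>

lemma form_approx_iff:
  "form_approx b m \<phi> f \<longleftrightarrow>
     f \<in> l2 m \<and> (\<forall>n. \<phi> n \<in> fin_supp) \<and> G.approximates (\<lambda>n. to_ell2 (\<phi> n)) (to_ell2 f)"
proof (cases "f \<in> l2 m \<and> (\<forall>n. \<phi> n \<in> fin_supp)")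
  case True
  then have f: "f \<in> l2 m" and \<phi>: "\<And>n. \<phi> n \<in> fin_supp" by auto
  note \<phi>2 = fin_supp_l2[OF \<phi>]
  have "l2_norm m (\<lambda>x. \<phi> n x - f x) = norm (to_ell2 (\<phi> n) - to_ell2 f)" for n
    using to_ell2_diff[OF \<phi>2 f] by (simp add: l2_norm_eq)
  then have "((\<lambda>n. l2_norm m (\<lambda>x. \<phi> n x - f x)) \<longlonglongrightarrow> 0) \<longleftrightarrow> (\<lambda>n. to_ell2 (\<phi> n)) \<longlonglongrightarrow> to_ell2 f"
    by (simp add: tendsto_norm_zero_iff LIM_zero_iff)
  moreover have "energy b (\<lambda>x. \<phi> i x - \<phi> j x) (\<lambda>x. \<phi> i x - \<phi> j x)
      = G.E (to_ell2 (\<phi> i) - to_ell2 (\<phi> j)) (to_ell2 (\<phi> i) - to_ell2 (\<phi> j))" for i j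
  proof -
    have "to_ell2 (\<phi> i) - to_ell2 (\<phi> j) \<in> finitely_supported" by (intro G.D_diff to_ell2_in_finitely_supported \<phi>)
    then show ?thesis
      using inner_graph_laplacian[of "to_ell2 (\<phi> i) - to_ell2 (\<phi> j)" "to_ell2 (\<phi> i) - to_ell2 (\<phi> j)"]
      by (simp add: of_ell2_diff of_to_ell2 \<phi>2)
  qed
  ultimately show ?thesis
    using True by (simp add: form_approx_def G.approximates_def to_ell2_in_finitely_supported)
next
  case False
  then show ?thesis by (auto simp: form_approx_def)
qed

lemma form_approx_of_ell2:
  assumes "f \<in> l2 m" "G.approximates \<psi> (to_ell2 f)"
  shows "form_approx b m (\<lambda>n. of_ell2 (\<psi> n)) f"
  using assms by (simp add: form_approx_iff G.approximates_def finitely_supported_iff)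

lemma form_domain_iff: "f \<in> form_domain b m \<longleftrightarrow> f \<in> l2 m \<and> to_ell2 f \<in> G.form_dom"
proof
  assume "f \<in> l2 m \<and> to_ell2 f \<in> G.form_dom"
  then show "f \<in> form_domain b m"
    using form_approx_of_ell2[of f] by (auto simp: form_domain_def G.form_dom_def)
qed (auto simp: form_domain_def G.form_dom_def form_approx_iff)

lemma closed_form_eq:
  assumes f: "f \<in> form_domain b m" and g: "g \<in> form_domain b m"
  shows "closed_form b m f g = G.form (to_ell2 f) (to_ell2 g)"
proof -
  have lim: "(\<lambda>n. energy b (\<phi> n) (\<psi> n)) \<longlonglongrightarrow> G.form (to_ell2 f) (to_ell2 g)"
    if "form_approx b m \<phi> f" "form_approx b m \<psi> g" for \<phi> \<psi>
    using that G.form_tendsto[of "\<lambda>n. to_ell2 (\<phi> n)" "to_ell2 f" "\<lambda>n. to_ell2 (\<psi> n)" "to_ell2 g"]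
    by (simp add: form_approx_iff E_to_ell2)
  obtain \<phi> \<psi> where \<phi>\<psi>: "form_approx b m \<phi> f" "form_approx b m \<psi> g"
    using f g by (auto simp: form_domain_def)
  show ?thesis unfolding closed_form_def
  proof (rule the_equality)
    fix q assume "\<forall>\<phi> \<psi>. form_approx b m \<phi> f \<longrightarrow> form_approx b m \<psi> g \<longrightarrow>
        (\<lambda>n. energy b (\<phi> n) (\<psi> n)) \<longlonglongrightarrow> q"
    then have "(\<lambda>n. energy b (\<phi> n) (\<psi> n)) \<longlonglongrightarrow> q" using \<phi>\<psi> by blast
    then show "q = G.form (to_ell2 f) (to_ell2 g)" using lim[OF \<phi>\<psi>] by (rule LIMSEQ_unique)
  qed (use lim in blast)
qed

lemma laplacian_iff:
  "(f, h) \<in> laplacian b m \<longleftrightarrow> f \<in> l2 m \<and> h \<in> l2 m \<and> (to_ell2 f, to_ell2 h) \<in> G.friedrichs"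
proof (cases "f \<in> form_domain b m \<and> h \<in> l2 m")
  case True
  then have f: "f \<in> form_domain b m" "f \<in> l2 m" "to_ell2 f \<in> G.form_dom" and h: "h \<in> l2 m"
    by (auto simp: form_domain_iff)
  have "(\<forall>g\<in>form_domain b m. closed_form b m f g = l2_inner m h g)
      \<longleftrightarrow> (\<forall>v\<in>G.form_dom. G.form (to_ell2 f) v = inner (to_ell2 h) v)"
  proof (intro iffI ballI)
    fix v assume *: "\<forall>g\<in>form_domain b m. closed_form b m f g = l2_inner m h g" and v: "v \<in> G.form_dom"
    have "of_ell2 v \<in> form_domain b m" using v by (simp add: form_domain_iff)
    with * closed_form_eq[OF f(1) this] inner_to_ell2[OF h, of "of_ell2 v"]
    show "G.form (to_ell2 f) v = inner (to_ell2 h) v" by simp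
  next
    fix g assume *: "\<forall>v\<in>G.form_dom. G.form (to_ell2 f) v = inner (to_ell2 h) v" and g: "g \<in> form_domain b m"
    then have "g \<in> l2 m" "to_ell2 g \<in> G.form_dom" by (auto simp: form_domain_iff)
    with * closed_form_eq[OF f(1) g] inner_to_ell2[OF h, of g]
    show "closed_form b m f g = l2_inner m h g" by simp
  qed
  with f h show ?thesis by (simp add: laplacian_def G.friedrichs_def)
next
  case False
  then show ?thesis by (auto simp: laplacian_def G.friedrichs_def form_domain_iff)
qed

section \<open>Identification of the heat semigroup\<close>

definition lift :: "(real \<Rightarrow> ('a \<Rightarrow> real) \<Rightarrow> 'a \<Rightarrow> real) \<Rightarrow> real \<Rightarrow> 'a ell2 \<Rightarrow> 'a ell2" where
  "lift T t u = to_ell2 (T t (of_ell2 u))"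

lemma lift_to_ell2: "f \<in> l2 m \<Longrightarrow> lift T t (to_ell2 f) = to_ell2 (T t f)"
  by (simp add: lift_def of_to_ell2)

lemma C0_semigroup_lift:
  assumes T: "strongly_continuous_semigroup m T"
  shows "C0_semigroup (lift T)"
proof -
  have l2: "T t f \<in> l2 m" if "t \<ge> 0" "f \<in> l2 m" for t f
    using T that by (simp add: strongly_continuous_semigroup_def)
  have lin: "T t (\<lambda>x. c * f x + d * g x) = (\<lambda>x. c * T t f x + d * T t g x)"
    if "t \<ge> 0" "f \<in> l2 m" "g \<in> l2 m" for t f g c d
    using T that by (simp add: strongly_continuous_semigroup_def)
  have "bounded_linear (lift T t)" if t: "t \<ge> 0" for t
  proof -
    have "\<exists>C. \<forall>f\<in>l2 m. l2_norm m (T t f) \<le> C * l2_norm m f"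
      using T t by (simp add: strongly_continuous_semigroup_def)
    then obtain C where C: "\<And>f. f \<in> l2 m \<Longrightarrow> l2_norm m (T t f) \<le> C * l2_norm m f"
      by blast
    have comb: "lift T t (c *\<^sub>R u + d *\<^sub>R v) = c *\<^sub>R lift T t u + d *\<^sub>R lift T t v" for c d u v
      using lin[OF t of_ell2_in_l2 of_ell2_in_l2, of c u d v] to_ell2_lincomb[OF l2[OF t of_ell2_in_l2] l2[OF t of_ell2_in_l2]]
      by (simp add: lift_def of_ell2_add of_ell2_scale)
    show ?thesis
    proof (rule bounded_linear_intro[where K = C])
      show "lift T t (u + v) = lift T t u + lift T t v" for u v using comb[of 1 u 1 v] by simp
      show "lift T t (r *\<^sub>R u) = r *\<^sub>R lift T t u" for r u using comb[of r u 0 u] by simp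
      show "norm (lift T t u) \<le> norm u * C" for u
        using C[of "of_ell2 u"] l2[OF t, of "of_ell2 u"] by (simp add: l2_norm_eq lift_def mult.commute)
    qed
  qed
  moreover have "lift T 0 u = u" for u
    using T by (simp add: strongly_continuous_semigroup_def lift_def)
  moreover have "lift T (s + t) u = lift T s (lift T t u)" if "s \<ge> 0" "t \<ge> 0" for s t u
    using T that l2[of t "of_ell2 u"] by (simp add: strongly_continuous_semigroup_def lift_def of_to_ell2)
  moreover have "((\<lambda>t. lift T t u) \<longlongrightarrow> u) (at_right 0)" for u
  proof -
    have "((\<lambda>t. l2_norm m (\<lambda>x. T t (of_ell2 u) x - of_ell2 u x)) \<longlongrightarrow> 0) (at_right 0)"
      using T by (simp add: strongly_continuous_semigroup_def)
    moreover have "eventually (\<lambda>t. l2_norm m (\<lambda>x. T t (of_ell2 u) x - of_ell2 u x) = norm (lift T t u - u)) (at_right 0)"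
      using eventually_at_right_less[of "0::real"]
    proof eventually_elim
      case (elim t)
      then show ?case
        using to_ell2_diff[OF l2[of t "of_ell2 u"] of_ell2_in_l2[of u]] by (simp add: l2_norm_eq lift_def)
    qed
    ultimately have "((\<lambda>t. norm (lift T t u - u)) \<longlongrightarrow> 0) (at_right 0)"
      using tendsto_cong by fast
    then show ?thesis by (simp add: tendsto_norm_zero_iff LIM_zero_iff)
  qed
  ultimately show ?thesis by (simp add: C0_semigroup_def)
qed

lemma generator_lift:
  assumes l2: "\<And>t f. t \<ge> 0 \<Longrightarrow> f \<in> l2 m \<Longrightarrow> T t f \<in> l2 m"
  shows "(f, g) \<in> generator m T \<longleftrightarrow>
    f \<in> l2 m \<and> g \<in> l2 m \<and> (to_ell2 f, to_ell2 g) \<in> infinitesimal_generator (lift T)"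
proof (cases "f \<in> l2 m \<and> g \<in> l2 m")
  case True
  then have f: "f \<in> l2 m" and g: "g \<in> l2 m" by auto
  have "eventually (\<lambda>t. l2_norm m (\<lambda>x. (T t f x - f x) / t - g x)
      = norm ((lift T t (to_ell2 f) - to_ell2 f) /\<^sub>R t - to_ell2 g)) (at_right 0)"
    using eventually_at_right_less[of "0::real"]
  proof eventually_elim
    case (elim t)
    then have Tf: "T t f \<in> l2 m" using l2 f by simp
    have 1: "(\<lambda>x. (1 / t) * (T t f x - f x) + 0 * f x) \<in> l2 m"
      "to_ell2 (\<lambda>x. (1 / t) * (T t f x - f x) + 0 * f x) = (1 / t) *\<^sub>R (to_ell2 (T t f) - to_ell2 f) + 0 *\<^sub>R to_ell2 f"
      using to_ell2_lincomb[OF to_ell2_diff(1)[OF Tf f] f, of "1 / t" 0] to_ell2_diff(2)[OF Tf f]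
      by simp_all
    then show ?case
      using to_ell2_diff[OF 1(1) g] f by (simp add: l2_norm_eq lift_to_ell2 inverse_eq_divide)
  qed
  then have "((\<lambda>t. l2_norm m (\<lambda>x. (T t f x - f x) / t - g x)) \<longlongrightarrow> 0) (at_right 0)
      \<longleftrightarrow> ((\<lambda>t. norm ((lift T t (to_ell2 f) - to_ell2 f) /\<^sub>R t - to_ell2 g)) \<longlongrightarrow> 0) (at_right 0)"
    by (rule tendsto_cong)
  then show ?thesis
    using True by (simp add: generator_def infinitesimal_generator_def tendsto_norm_zero_iff LIM_zero_iff)
next
  case False
  then show ?thesis by (auto simp: generator_def)
qed

lemma minus_laplacian_iff:
  "(f, g) \<in> {(f, \<lambda>x. - h x) | f h. (f, h) \<in> laplacian b m} \<longleftrightarrow>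
    f \<in> l2 m \<and> g \<in> l2 m \<and> (to_ell2 f, to_ell2 g) \<in> G.heat_generator"
proof -
  have "(f, g) \<in> {(f, \<lambda>x. - h x) | f h. (f, h) \<in> laplacian b m} \<longleftrightarrow> (f, \<lambda>x. - g x) \<in> laplacian b m"
  proof
    assume "(f, \<lambda>x. - g x) \<in> laplacian b m"
    then show "(f, g) \<in> {(f, \<lambda>x. - h x) | f h. (f, h) \<in> laplacian b m}"
      unfolding mem_Collect_eq by (intro exI[of _ f] exI[of _ "\<lambda>x. - g x"]) simp
  qed auto
  moreover have "(\<lambda>x. - g x) \<in> l2 m \<longleftrightarrow> g \<in> l2 m" by (simp add: l2_def)
  moreover have "to_ell2 (\<lambda>x. - g x) = - to_ell2 g" if "g \<in> l2 m"
    using to_ell2_lincomb(2)[OF that that, of "-1" 0] by simp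
  ultimately show ?thesis by (auto simp: laplacian_iff G.heat_generator_def)
qed

text \<open>The heat semigroup is specified by its generator; existence makes this specification usable and
  the uniqueness theorem makes it determine the operators.\<close>

lemma heat_semigroup_exists:
  "\<exists>T. strongly_continuous_semigroup m T \<and>
     generator m T = {(f, \<lambda>x. - h x) | f h. (f, h) \<in> laplacian b m}"
proof (intro exI conjI)
  define T where "T t f = of_ell2 (G.heat.P t (to_ell2 f))" for t f
  have l2: "T t f \<in> l2 m" for t f by (simp add: T_def)
  have lift: "lift T = G.heat.P" by (simp add: lift_def T_def fun_eq_iff)
  show "strongly_continuous_semigroup m T"
    unfolding strongly_continuous_semigroup_def
  proof (intro conjI ballI allI impI)
    fix t :: real and f assume t: "t \<ge> 0" and f: "f \<in> l2 m"
    show "T t f \<in> l2 m" by (rule l2)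
    fix g c d assume g: "g \<in> l2 m"
    show "T t (\<lambda>x. c * f x + d * g x) = (\<lambda>x. c * T t f x + d * T t g x)"
      using t by (simp add: T_def to_ell2_lincomb f g G.heat.P_add G.heat.P_scale of_ell2_add of_ell2_scale)
  next
    fix t :: real assume t: "t \<ge> 0"
    show "\<exists>C. \<forall>f\<in>l2 m. l2_norm m (T t f) \<le> C * l2_norm m f"
      using G.heat.P_norm[OF t] by (intro exI[of _ 1]) (simp add: T_def l2_norm_eq)
  next
    fix f assume f: "f \<in> l2 m"
    show "T 0 f = f" by (simp add: T_def G.heat.P_0 of_to_ell2 f)
    show "T (s + t) f = T s (T t f)" if "s \<ge> 0" "t \<ge> 0" for s t
      using that by (simp add: T_def G.heat.P_semigroup)
    have "((\<lambda>t. norm (G.heat.P t (to_ell2 f) - to_ell2 f)) \<longlongrightarrow> 0) (at_right 0)"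
      using G.heat.P_strongly_continuous[of "to_ell2 f"] by (simp add: tendsto_norm_zero_iff LIM_zero_iff)
    moreover have "l2_norm m (\<lambda>x. T t f x - f x) = norm (G.heat.P t (to_ell2 f) - to_ell2 f)" for t
      using to_ell2_diff[OF l2 f] by (simp add: l2_norm_eq) (simp add: T_def)
    ultimately show "((\<lambda>t. l2_norm m (\<lambda>x. T t f x - f x)) \<longlongrightarrow> 0) (at_right 0)" by simp
  qed
  show "generator m T = {(f, \<lambda>x. - h x) | f h. (f, h) \<in> laplacian b m}"
  proof (rule set_eqI)
    fix p :: "('a \<Rightarrow> real) \<times> ('a \<Rightarrow> real)"
    obtain f g where p: "p = (f, g)" by (cases p)
    show "p \<in> generator m T \<longleftrightarrow> p \<in> {(f, \<lambda>x. - h x) | f h. (f, h) \<in> laplacian b m}"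
      unfolding p minus_laplacian_iff generator_lift[of T, OF l2] lift G.heat.generator_P ..
  qed
qed

abbreviation H :: "real \<Rightarrow> ('a \<Rightarrow> real) \<Rightarrow> 'a \<Rightarrow> real" where
  "H \<equiv> heat_semigroup b m"

lemma heat_semigroup_spec:
  "strongly_continuous_semigroup m H"
  "generator m H = {(f, \<lambda>x. - h x) | f h. (f, h) \<in> laplacian b m}"
  using someI_ex[OF heat_semigroup_exists] unfolding heat_semigroup_def by auto

lemma heat_semigroup_eq:
  assumes t: "t \<ge> 0" and f: "f \<in> l2 m"
  shows "H t f = of_ell2 (G.heat.P t (to_ell2 f))"
proof -
  have l2: "H t f \<in> l2 m" if "t \<ge> 0" "f \<in> l2 m" for t f
    using heat_semigroup_spec(1) that by (simp add: strongly_continuous_semigroup_def)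
  have gen: "infinitesimal_generator (lift H) = G.heat_generator"
  proof (rule set_eqI)
    fix p :: "'a ell2 \<times> 'a ell2"
    obtain u v where p: "p = (u, v)" by (cases p)
    have "(of_ell2 u, of_ell2 v) \<in> generator m H \<longleftrightarrow> (u, v) \<in> infinitesimal_generator (lift H)"
      using generator_lift[of H "of_ell2 u" "of_ell2 v", OF l2] by simp
    moreover have "(of_ell2 u, of_ell2 v) \<in> generator m H \<longleftrightarrow> (u, v) \<in> G.heat_generator"
      unfolding heat_semigroup_spec(2) minus_laplacian_iff by simp
    ultimately show "p \<in> infinitesimal_generator (lift H) \<longleftrightarrow> p \<in> G.heat_generator" by (simp add: p)
  qed
  have "to_ell2 (H t f) = G.heat.P t (to_ell2 f)"
    using G.heat.C0_semigroup_unique[OF C0_semigroup_lift[OF heat_semigroup_spec(1)] gen t, of "to_ell2 f"] f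
    by (simp add: lift_to_ell2)
  then show ?thesis using l2[OF t f] by (simp add: to_ell2_eq_iff)
qed

section \<open>Contraction in the supremum norm\<close>

definition clip :: "real \<Rightarrow> real \<Rightarrow> real" where
  "clip C r = max (- C) (min C r)"

lemma clip_simps:
  assumes "C \<ge> 0"
  shows "clip C 0 = 0" "\<bar>clip C r\<bar> \<le> C" "\<bar>clip C r - clip C s\<bar> \<le> \<bar>r - s\<bar>"
    "\<bar>s\<bar> \<le> C \<Longrightarrow> clip C s = s"
  using assms by (auto simp: clip_def)

text \<open>Truncation does not increase differences along edges.\<close>

lemma energy_clip_le:
  assumes f: "f \<in> fin_supp" and C: "C \<ge> 0"
  shows "energy b (\<lambda>x. clip C (f x)) (\<lambda>x. clip C (f x)) \<le> energy b f f"
proof -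
  have summable: "(\<lambda>(x, y). b x y * (g x - g y) * (g x - g y)) summable_on UNIV" if g: "g \<in> fin_supp" for g
  proof -
    have "(\<lambda>(x, y). b x y * (g x - g y) * (g x - g y)) summable_on
        {(x, y). b x y \<noteq> 0 \<and> (g x \<noteq> 0 \<or> g y \<noteq> 0)}"
      by (intro summable_on_finite finite_edge_support g)
    also have "?this \<longleftrightarrow> (\<lambda>(x, y). b x y * (g x - g y) * (g x - g y)) summable_on UNIV"
      by (rule summable_on_cong_neutral) auto
    finally show ?thesis .
  qed
  have "(\<lambda>x. clip C (f x)) \<in> fin_supp"
    using f clip_simps(1)[OF C] unfolding fin_supp_def by (auto elim!: rev_finite_subset)
  moreover have "b x y * (clip C (f x) - clip C (f y)) * (clip C (f x) - clip C (f y))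
      \<le> b x y * (f x - f y) * (f x - f y)" for x y
    unfolding mult.assoc using b_nonneg[of x y] clip_simps(3)[OF C, of "f x" "f y"]
    by (intro mult_left_mono) (auto simp: abs_le_square_iff power2_eq_square)
  ultimately show ?thesis
    unfolding energy_def using summable f
    by (intro divide_right_mono infsum_mono) (auto split: prod.splits)
qed

text \<open>Truncation at level \<open>C\<close> lowers the energy and the distance to every function bounded by \<open>C\<close>,
  so the Beurling-Deny argument applies to the closed set of functions bounded by \<open>C\<close>.\<close>

lemma heat_semigroup_sup_contraction:
  assumes t: "t \<ge> 0" and f: "f \<in> l2 m" and C: "\<And>x. \<bar>f x\<bar> \<le> C"
  shows "\<bar>H t f x\<bar> \<le> C"
proof -
  have C0: "C \<ge> 0" using C[of undefined] by simp
  define K where "K = {u. \<forall>x. \<bar>of_ell2 u x\<bar> \<le> C}"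
  define \<kappa> where "\<kappa> v = to_ell2 (\<lambda>x. clip C (of_ell2 v x))" for v
  have supp: "(\<lambda>x. clip C (of_ell2 v x)) \<in> fin_supp" if "v \<in> finitely_supported" for v
    using that clip_simps(1)[OF C0] unfolding finitely_supported_iff fin_supp_def
    by (auto elim!: rev_finite_subset)
  have of_ell2\<kappa>: "of_ell2 (\<kappa> v) = (\<lambda>x. clip C (of_ell2 v x))" if "v \<in> finitely_supported" for v
    using supp[OF that] by (simp add: \<kappa>_def of_to_ell2 fin_supp_l2)
  have "G.heat.P t (to_ell2 f) \<in> K"
  proof (rule G.heat_P_in_closed[where \<kappa> = \<kappa>])
    have "K = (\<Inter>x. {u. \<bar>of_ell2 u x\<bar> \<le> C})" by (auto simp: K_def)
    also have "closed \<dots>"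
      unfolding of_ell2_def
      by (intro closed_INT ballI closed_Collect_le continuous_intros
          linear_continuous_on bounded_linear_ell2_apply) (simp add: less_imp_neq[OF m_simps(1), symmetric])
    finally show "closed K" .
    show "\<kappa> v \<in> finitely_supported \<inter> K" if "v \<in> finitely_supported" for v
      using supp[OF that] clip_simps(2)[OF C0]
      by (simp add: finitely_supported_iff of_ell2\<kappa>[OF that] K_def)
    show "G.E (\<kappa> v) (\<kappa> v) \<le> G.E v v" if "v \<in> finitely_supported" for v
      using energy_clip_le[of "of_ell2 v" C] that C0 supp[OF that]
      by (simp add: inner_graph_laplacian finitely_supported_iff of_ell2\<kappa>)
    show "norm (\<kappa> v - u) \<le> norm (v - u)" if v: "v \<in> finitely_supported" and u: "u \<in> K" for v u
    proof (rule norm_ell2_mono)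
      fix x
      have apply_fn: "ell2_apply w x = of_ell2 w x * sqrt (m x)" for w
        using less_imp_neq[OF m_simps(1)[of x]] by (simp add: of_ell2_def)
      have "\<bar>clip C (of_ell2 v x) - of_ell2 u x\<bar> \<le> \<bar>of_ell2 v x - of_ell2 u x\<bar>"
        using clip_simps(3)[OF C0, of "of_ell2 v x" "of_ell2 u x"] clip_simps(4)[OF C0, of "of_ell2 u x"] u
        by (simp add: K_def)
      then show "\<bar>ell2_apply (\<kappa> v - u) x\<bar> \<le> \<bar>ell2_apply (v - u) x\<bar>"
        unfolding apply_fn of_ell2_diff of_ell2\<kappa>[OF v] abs_mult by (intro mult_right_mono) auto
    qed
    show "to_ell2 f \<in> K" using C by (simp add: K_def of_to_ell2 f)
  qed (rule t)
  then show ?thesis by (simp add: K_def heat_semigroup_eq[OF t f])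
qed

lemma sum_indicator_singleton:
  assumes "finite F"
  shows "(\<Sum>y\<in>F. c y * indicator {y} z) = (if z \<in> F then c z else 0 :: real)"
proof -
  have "(\<Sum>y\<in>F. c y * indicator {y} z) = (\<Sum>y\<in>F. if y = z then c y else 0)"
    by (intro sum.cong) (auto simp: indicator_def)
  then show ?thesis using assms by (simp add: sum.delta')
qed

lemma heat_semigroup_sum:
  assumes t: "t \<ge> 0" and F: "finite F"
  shows "H t (\<lambda>z. \<Sum>y\<in>F. c y * indicator {y} z) = (\<lambda>x. \<Sum>y\<in>F. c y * H t (indicator {y}) x)"
proof -
  have lin: "H t (\<lambda>x. c * f x + d * g x) = (\<lambda>x. c * H t f x + d * H t g x)"
    if "f \<in> l2 m" "g \<in> l2 m" for f g c d
    using heat_semigroup_spec(1) that t by (simp add: strongly_continuous_semigroup_def)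
  have ind: "indicator {y} \<in> l2 m" for y
    by (intro fin_supp_l2) (simp add: fin_supp_def indicator_def)
  show ?thesis
    using F
  proof (induction F)
    case empty
    show ?case using lin[OF fin_supp_l2 fin_supp_l2, of "\<lambda>_. 0" "\<lambda>_. 0" 0 0] by (simp add: fin_supp_def)
  next
    case (insert y F)
    have "(\<lambda>z. \<Sum>y\<in>F. c y * indicator {y} z) \<in> fin_supp"
    proof -
      have "{z. (\<Sum>y\<in>F. c y * indicator {y} z) \<noteq> 0} \<subseteq> F"
        unfolding sum_indicator_singleton[OF insert.hyps(1)] by auto
      then show ?thesis using insert finite_subset by (auto simp: fin_supp_def)
    qed
    from lin[OF ind fin_supp_l2[OF this], of "c y" y 1]
    show ?case unfolding sum.insert[OF insert.hyps] insert.IH mult_1 .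
  qed
qed

text \<open>The sup norm contraction is tested against the signs of the row.\<close>

lemma heat_kernel_row_sum:
  assumes t: "t \<ge> 0" and F: "finite F"
  shows "(\<Sum>y\<in>F. \<bar>H t (indicator {y}) x\<bar>) \<le> 1"
proof -
  let ?a = "\<lambda>y. H t (indicator {y}) x"
  define f where "f z = (\<Sum>y\<in>F. sgn (?a y) * indicator {y} z)" for z
  have f: "f z = (if z \<in> F then sgn (?a z) else 0)" for z
    unfolding f_def by (rule sum_indicator_singleton[OF F])
  have "{z. f z \<noteq> 0} \<subseteq> F" by (auto simp: f)
  then have "f \<in> fin_supp" using F finite_subset by (auto simp: fin_supp_def)
  then have "\<bar>H t f x\<bar> \<le> 1"
  proof (intro heat_semigroup_sup_contraction[OF t] fin_supp_l2)
    show "\<bar>f z\<bar> \<le> 1" for z unfolding f by (simp add: abs_sgn_eq)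
  qed
  moreover have "H t f x = (\<Sum>y\<in>F. \<bar>?a y\<bar>)"
  proof -
    have "f = (\<lambda>z. \<Sum>y\<in>F. sgn (?a y) * indicator {y} z)" by (simp add: f_def fun_eq_iff)
    then have "H t f = (\<lambda>x'. \<Sum>y\<in>F. sgn (?a y) * H t (indicator {y}) x')"
      using heat_semigroup_sum[OF t F, of "\<lambda>y. sgn (?a y)"] by simp
    then show ?thesis by (simp add: abs_sgn mult.commute)
  qed
  ultimately show ?thesis by simp
qed

section \<open>The Feller property\<close>

lemma heat_action_eq: "heat_action b m t f x = (\<Sum>\<^sub>\<infinity>y. H t (indicator {y}) x * f y)"
  unfolding heat_action_def heat_kernel_def by simp

lemma heat_kernel_summable:
  assumes t: "t \<ge> 0" and B: "\<And>y. \<bar>f y\<bar> \<le> B"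
  shows "(\<lambda>y. norm (H t (indicator {y}) x * f y)) summable_on UNIV"
    and "\<bar>heat_action b m t f x\<bar> \<le> B"
proof -
  let ?a = "\<lambda>y. H t (indicator {y}) x"
  have B0: "B \<ge> 0" using B[of undefined] by simp
  have a: "(\<lambda>y. \<bar>?a y\<bar>) summable_on UNIV"
    by (rule nonneg_bdd_above_summable_on)
      (auto intro!: bdd_aboveI[of _ 1] heat_kernel_row_sum t)
  have a1: "(\<Sum>\<^sub>\<infinity>y. \<bar>?a y\<bar>) \<le> 1"
    by (rule infsum_le_finite_sums[OF a]) (auto intro: heat_kernel_row_sum t)
  have le: "norm (?a y * f y) \<le> \<bar>?a y\<bar> * B" for y
    using B[of y] by (simp add: abs_mult mult_left_mono)
  show s: "(\<lambda>y. norm (?a y * f y)) summable_on UNIV"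
    by (rule summable_on_comparison_test[OF summable_on_cmult_left[OF a, of B]]) (use le in auto)
  have "\<bar>heat_action b m t f x\<bar> \<le> (\<Sum>\<^sub>\<infinity>y. norm (?a y * f y))"
    unfolding heat_action_eq using norm_infsum_bound[OF s] by simp
  also have "\<dots> \<le> (\<Sum>\<^sub>\<infinity>y. \<bar>?a y\<bar> * B)"
    by (intro infsum_mono s summable_on_cmult_left a le)
  also have "\<dots> = (\<Sum>\<^sub>\<infinity>y. \<bar>?a y\<bar>) * B" by (rule infsum_cmult_left')
  also have "\<dots> \<le> 1 * B" using a1 B0 by (rule mult_right_mono)
  finally show "\<bar>heat_action b m t f x\<bar> \<le> B" by simp
qed

lemma heat_action_fin_supp:
  assumes t: "t \<ge> 0" and \<phi>: "\<phi> \<in> fin_supp"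
  shows "heat_action b m t \<phi> = H t \<phi>"
proof
  fix x
  let ?F = "{y. \<phi> y \<noteq> 0}"
  have F: "finite ?F" using \<phi> by (simp add: fin_supp_def)
  have "heat_action b m t \<phi> x = (\<Sum>\<^sub>\<infinity>y\<in>?F. \<phi> y * H t (indicator {y}) x)"
    unfolding heat_action_eq by (rule infsum_cong_neutral) auto
  also have "\<dots> = H t (\<lambda>z. \<Sum>y\<in>?F. \<phi> y * indicator {y} z) x"
    using F heat_semigroup_sum[OF t F, of \<phi>] by simp
  also have "(\<lambda>z. \<Sum>y\<in>?F. \<phi> y * indicator {y} z) = \<phi>"
    unfolding sum_indicator_singleton[OF F] by auto
  finally show "heat_action b m t \<phi> x = H t \<phi> x" .
qed

lemma l2_vanishing_at_infinity:
  assumes c: "c > 0" "\<And>x. c \<le> m x" and f: "f \<in> l2 m"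
  shows "f \<in> vanishing_at_infinity"
  unfolding vanishing_at_infinity_iff
proof (intro allI impI)
  fix e :: real assume e: "e > 0"
  have "finite {x. \<bar>ell2_apply (to_ell2 f) x\<bar> > e * sqrt c}"
    using e c by (intro finite_ell2_superlevel) simp
  moreover have "{x. \<bar>f x\<bar> > e} \<subseteq> {x. \<bar>ell2_apply (to_ell2 f) x\<bar> > e * sqrt c}"
  proof safe
    fix x assume x: "\<bar>f x\<bar> > e"
    have "e * sqrt c < \<bar>f x\<bar> * sqrt c" using x c by simp
    also have "\<dots> \<le> \<bar>f x\<bar> * sqrt (m x)" using c by (intro mult_left_mono) auto
    finally show "\<bar>ell2_apply (to_ell2 f) x\<bar> > e * sqrt c" by (simp add: to_ell2_apply f abs_mult)
  qed
  ultimately show "finite {x. \<bar>f x\<bar> > e}" by (rule rev_finite_subset)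
qed

text \<open>A finitely supported \<open>\<phi>\<close> is mapped into \<open>l2 m\<close>, hence to a function vanishing at infinity, and the
  heat action is a contraction in the sup norm, so the property passes to uniform limits.\<close>

lemma feller_if_measure_bounded_below:
  assumes c: "c > 0" "\<And>x. c \<le> m x"
  shows "feller b m"
  unfolding feller_def
proof (intro allI impI ballI)
  fix t :: real and f :: "'a \<Rightarrow> real" assume t: "t \<ge> 0" and f: "f \<in> vanishing_at_infinity"
  show "heat_action b m t f \<in> vanishing_at_infinity"
  proof (rule vanishing_at_infinity_closed)
    fix e :: real assume e: "e > 0"
    obtain \<phi>' where \<phi>': "\<And>n. \<phi>' n \<in> fin_supp" "uniform_limit UNIV \<phi>' f sequentially"
      using f by (auto simp: vanishing_at_infinity_def)
    obtain n where n: "\<And>x. dist (\<phi>' n x) (f x) < e"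
      using uniform_limitD[OF \<phi>'(2) e] by (auto simp: eventually_sequentially)
    define \<phi> where "\<phi> = \<phi>' n"
    have \<phi>: "\<phi> \<in> fin_supp" and close: "\<And>x. \<bar>f x - \<phi> x\<bar> \<le> e"
      using \<phi>' n by (auto simp: \<phi>_def dist_real_def abs_minus_commute intro: less_imp_le)
    have "H t \<phi> \<in> l2 m" by (simp add: heat_semigroup_eq[OF t fin_supp_l2[OF \<phi>]])
    then have "heat_action b m t \<phi> \<in> vanishing_at_infinity"
      using l2_vanishing_at_infinity[OF c] heat_action_fin_supp[OF t \<phi>] by simp
    moreover have "\<bar>heat_action b m t f x - heat_action b m t \<phi> x\<bar> \<le> e" for x
    proof -
      let ?a = "\<lambda>y. H t (indicator {y}) x"
      obtain B where B: "\<And>y. \<bar>\<phi> y\<bar> \<le> B"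
        using vanishing_at_infinity_bounded[OF fin_supp_vanishing[OF \<phi>]] by blast
      have "heat_action b m t f x = (\<Sum>\<^sub>\<infinity>y. ?a y * (f y - \<phi> y) + ?a y * \<phi> y)"
        unfolding heat_action_eq by (simp add: right_diff_distrib)
      also have "\<dots> = heat_action b m t (\<lambda>y. f y - \<phi> y) x + heat_action b m t \<phi> x"
        unfolding heat_action_eq
        by (rule infsum_add[OF abs_summable_summable abs_summable_summable,
              OF heat_kernel_summable(1)[OF t close] heat_kernel_summable(1)[OF t B]])
      finally show ?thesis using heat_kernel_summable(2)[OF t close] by simp
    qed
    ultimately show "\<exists>g\<in>vanishing_at_infinity. \<forall>x. \<bar>heat_action b m t f x - g x\<bar> \<le> e" by blast
  qed
qed

end

theorem proposition4p5:
  fixes b :: "'a \<Rightarrow> 'a \<Rightarrow> real" and m :: "'a \<Rightarrow> real"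
  assumes "weighted_graph b m"
    and "graph_connected b"
    and "(INF x. m x) > 0"
  shows "feller b m"
proof -
  interpret weighted_graph b m by fact
  have "bdd_below (range m)" using m_pos by (intro bdd_belowI[of _ 0]) (auto intro: less_imp_le)
  then have "(INF x. m x) \<le> m x" for x by (rule cINF_lower) simp
  then show ?thesis using assms(3) by (rule feller_if_measure_bounded_below[rotated])
qed

end
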